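(* (Direct part.) Let $I\subset\mathbb{R}$ be an open interval and let $r:I\to\mathbb{R}$ be a smooth positive function with $r r''+(r')^2+1\neq 0$ at every point of $I$. Let $\eta\in\{1,-1\}$, let $\varphi$ be any antiderivative on $I$ of $$\eta\,\frac{r r''+(r')^2+1}{r\,(1+(r')^2)},$$ and let $x_1,x_2$ be any antiderivatives on $I$ of $\sqrt{1+(r')^2}\,\cos\varphi$ and $\sqrt{1+(r')^2}\,\sin\varphi$, respectively. Then $c:\ \widetilde z(u)=(x_1(u),x_2(u),r(u),0)$, $u\in I$, is a spacelike curve in $\mathbb{E}^4_2$ and the rotational surface of elliptic type $$z(u,v)=(x_1(u),x_2(u),r(u)\cos v,r(u)\sin v),\quad u\in I,\ v\in[0,2\pi),$$ generated by $c$ is quasi-minimal. (Converse part.) Let $\mathcal{M}'$ be a quasi-minimal rotational surface of elliptic type, generated by an arc-length parameterized spacelike curve $\widetilde z(u)=(x_1(u),x_2(u),r(u),0)$, $u\in J$, with $r>0$. Then $\mathcal{M}'$ is locally constructed as in the direct part: every $u_0\in J$ has an open interval $I\subset J$ containing it, together with some $\eta\in\{1,-1\}$ and a smooth function $\varphi:I\to\mathbb{R}$, such that on $I$ one has $r r''+(r')^2+1\neq 0$ and $$\varphi'=\eta\,\frac{r r''+(r')^2+1}{r(1+(r')^2)},\qquad x_1'=\sqrt{1+(r')^2}\cos\varphi,\qquad x_2'=\sqrt{1+(r')^2}\sin\varphi .$$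
   Context: $\mathbb{E}^4_2$ is $\mathbb{R}^4$ with the indefinite inner product $\langle x,y\rangle=x_1y_1+x_2y_2-x_3y_3-x_4y_4$. A vector $v$ is spacelike if $\langle v,v\rangle>0$, timelike if $\langle v,v\rangle<0$, lightlike if $v\ne0$ and $\langle v,v\rangle=0$. A smooth curve is spacelike if its velocity is spacelike at each point. A surface is Lorentz if its induced metric has signature $(1,1)$; then its normal spaces also have signature $(1,1)$. For a Lorentz surface, the second fundamental form $\sigma(x,y)$ is the normal component of $\nabla'_x y$, where $\nabla'$ is the flat connection of $\mathbb{E}^4_2$ and $x,y$ are tangent vector fields. The mean curvature vector is $H=\frac12\operatorname{tr}\sigma$ (trace with respect to the induced metric), i.e. $H=\frac12(\sigma(X,X)-\sigma(Y,Y))$ for an orthonormal tangent frame with $\langle X,X\rangle=1$, $\langle Y,Y\rangle=-1$, $\langle X,Y\rangle=0$. The surface is quasi-minimal if $H$ is lightlike at each point, i.e. $H\neq0$ and $\langle H,H\rangle=0$ everywhere. Rotational surface of elliptic type: let $J\subset\mathbb{R}$ be an open interval and $\widetilde z(u)=(x_1(u),x_2(u),r(u),0)$, $u\in J$, a smooth spacelike curve with $r>0$, parameterized by arc-length, i.e. $(x_1')^2+(x_2')^2-(r')^2=1$. The rotational surface of elliptic type $\mathcal{M}'$ generated by it is $z(u,v)=(x_1(u),x_2(u),r(u)\cos v,r(u)\sin v)$, $u\in J$, $v\in[0,2\pi)$. It is a Lorentz surface with $\langle z_u,z_u\rangle=1$, $\langle z_u,z_v\rangle=0$, $\langle z_v,z_v\rangle=-r^2$.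 *)

theory Defs
  imports "HOL-Analysis.Analysis"
begin

section \<open>Smooth maps\<close>

text \<open>
  Derivatives are taken with respect to \<open>at x\<close>, not \<open>at x within S\<close>; for an open
  set \<open>S\<close> the predicate says that \<open>f\<close> is of class \<open>C\<^sup>n\<close> on \<open>S\<close>.
\<close>

fun times_differentiable_on ::
    "nat \<Rightarrow> ('a::euclidean_space \<Rightarrow> 'b::real_normed_vector) \<Rightarrow> 'a set \<Rightarrow> bool" where
  "times_differentiable_on 0 f S \<longleftrightarrow> continuous_on S f"
| "times_differentiable_on (Suc n) f S \<longleftrightarrow>
     (\<forall>x\<in>S. f differentiable (at x)) \<and>
     (\<forall>v. times_differentiable_on n (\<lambda>x. frechet_derivative f (at x) v) S)"

text \<open>
  As usual, smoothness on a set that is not open, such as \<open>I \<times> [0, 2\<pi>)\<close>, means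
  smoothness on some open set containing it.
\<close>

definition smooth_on :: "'a set \<Rightarrow> ('a::euclidean_space \<Rightarrow> 'b::real_normed_vector) \<Rightarrow> bool" where
  "smooth_on S f \<longleftrightarrow> (\<exists>W. open W \<and> S \<subseteq> W \<and> (\<forall>n. times_differentiable_on n f W))"


section \<open>The pseudo-Euclidean space of dimension 4 and index 2\<close>

definition ip :: "real ^ 4 \<Rightarrow> real ^ 4 \<Rightarrow> real" where
  "ip x y = x $ 1 * y $ 1 + x $ 2 * y $ 2 - x $ 3 * y $ 3 - x $ 4 * y $ 4"

definition spacelike :: "real ^ 4 \<Rightarrow> bool" where
  "spacelike v \<longleftrightarrow> ip v v > 0"

definition lightlike :: "real ^ 4 \<Rightarrow> bool" where
  "lightlike v \<longleftrightarrow> v \<noteq> 0 \<and> ip v v = 0"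

definition spacelike_curve :: "real set \<Rightarrow> (real \<Rightarrow> real ^ 4) \<Rightarrow> bool" where
  "spacelike_curve I c \<longleftrightarrow>
     smooth_on I c \<and> (\<forall>u\<in>I. spacelike (vector_derivative c (at u)))"

definition arc_length_parameterized :: "real set \<Rightarrow> (real \<Rightarrow> real ^ 4) \<Rightarrow> bool" where
  "arc_length_parameterized I c \<longleftrightarrow>
     (\<forall>u\<in>I. ip (vector_derivative c (at u)) (vector_derivative c (at u)) = 1)"


section \<open>Lorentz surfaces\<close>

text \<open>
  A surface is given by a parametrization \<open>z\<close>. A tangent vector field is represented
  by its coordinate field \<open>X\<close> on the parameter domain: the pair \<open>X p = (a, b)\<close> stands
  for \<open>a z\<^sub>u + b z\<^sub>v\<close> at \<open>p\<close>.
\<close>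

definition tangent_field ::
    "(real \<times> real \<Rightarrow> real ^ 4) \<Rightarrow> (real \<times> real \<Rightarrow> real \<times> real) \<Rightarrow> real \<times> real \<Rightarrow> real ^ 4" where
  "tangent_field z X p = frechet_derivative z (at p) (X p)"

definition tangent_space :: "(real \<times> real \<Rightarrow> real ^ 4) \<Rightarrow> real \<times> real \<Rightarrow> (real ^ 4) set" where
  "tangent_space z p = range (frechet_derivative z (at p))"

definition normal_space :: "(real \<times> real \<Rightarrow> real ^ 4) \<Rightarrow> real \<times> real \<Rightarrow> (real ^ 4) set" where
  "normal_space z p = {n. \<forall>t \<in> tangent_space z p. ip n t = 0}"

definition lorentz_surface :: "(real \<times> real) set \<Rightarrow> (real \<times> real \<Rightarrow> real ^ 4) \<Rightarrow> bool" where
  "lorentz_surface S z \<longleftrightarrow>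
     smooth_on S z \<and>
     (\<forall>p\<in>S. inj (frechet_derivative z (at p)) \<and>
        (\<exists>e \<in> tangent_space z p. \<exists>f \<in> tangent_space z p.
           ip e e = 1 \<and> ip f f = -1 \<and> ip e f = 0))"

text \<open>
  Well defined where the tangent space is nondegenerate, in particular on Lorentz surfaces.
\<close>

definition normal_component ::
    "(real \<times> real \<Rightarrow> real ^ 4) \<Rightarrow> real \<times> real \<Rightarrow> real ^ 4 \<Rightarrow> real ^ 4" where
  "normal_component z p w = (THE n. n \<in> normal_space z p \<and> w - n \<in> tangent_space z p)"

text \<open>
  The flat connection differentiates the \<open>\<real>\<^sup>4\<close>-valued field \<open>tangent_field z Y\<close> in the
  direction of \<open>X\<close>; in the parameter domain this direction is \<open>X p\<close>.
\<close>

definition flat_connection ::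
    "(real \<times> real \<Rightarrow> real ^ 4) \<Rightarrow> (real \<times> real \<Rightarrow> real \<times> real) \<Rightarrow>
     (real \<times> real \<Rightarrow> real \<times> real) \<Rightarrow> real \<times> real \<Rightarrow> real ^ 4" where
  "flat_connection z X Y p = frechet_derivative (tangent_field z Y) (at p) (X p)"

definition second_fundamental_form ::
    "(real \<times> real \<Rightarrow> real ^ 4) \<Rightarrow> (real \<times> real \<Rightarrow> real \<times> real) \<Rightarrow>
     (real \<times> real \<Rightarrow> real \<times> real) \<Rightarrow> real \<times> real \<Rightarrow> real ^ 4" where
  "second_fundamental_form z X Y p = normal_component z p (flat_connection z X Y p)"

definition orthonormal_frame_on ::
    "(real \<times> real) set \<Rightarrow> (real \<times> real \<Rightarrow> real ^ 4) \<Rightarrow>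
     (real \<times> real \<Rightarrow> real \<times> real) \<Rightarrow> (real \<times> real \<Rightarrow> real \<times> real) \<Rightarrow> bool" where
  "orthonormal_frame_on W z X Y \<longleftrightarrow>
     smooth_on W X \<and> smooth_on W Y \<and>
     (\<forall>q\<in>W. ip (tangent_field z X q) (tangent_field z X q) = 1 \<and>
            ip (tangent_field z Y q) (tangent_field z Y q) = -1 \<and>
            ip (tangent_field z X q) (tangent_field z Y q) = 0)"

text \<open>
  Half the trace of the second fundamental form with respect to the induced metric.
  On a Lorentz surface local orthonormal frames exist and the value does not depend
  on the frame.
\<close>

definition mean_curvature :: "(real \<times> real \<Rightarrow> real ^ 4) \<Rightarrow> real \<times> real \<Rightarrow> real ^ 4" where
  "mean_curvature z p =
     (THE H. \<exists>W X Y. open W \<and> p \<in> W \<and> orthonormal_frame_on W z X Y \<and>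
        H = (1 / 2) *\<^sub>R (second_fundamental_form z X X p - second_fundamental_form z Y Y p))"

definition quasi_minimal :: "(real \<times> real) set \<Rightarrow> (real \<times> real \<Rightarrow> real ^ 4) \<Rightarrow> bool" where
  "quasi_minimal S z \<longleftrightarrow>
     lorentz_surface S z \<and> (\<forall>p\<in>S. lightlike (mean_curvature z p))"


section \<open>Rotational surfaces of elliptic type\<close>

definition generating_curve ::
    "(real \<Rightarrow> real) \<Rightarrow> (real \<Rightarrow> real) \<Rightarrow> (real \<Rightarrow> real) \<Rightarrow> real \<Rightarrow> real ^ 4" where
  "generating_curve x1 x2 r u = vector [x1 u, x2 u, r u, 0]"

text \<open>
  The formula is used for all \<open>v\<close>, so that the derivatives in \<open>v\<close> at \<open>v = 0\<close> are
  two-sided; the surface itself is its restriction to \<open>I \<times> [0, 2\<pi>)\<close>.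
\<close>

definition elliptic_rotational_surface ::
    "(real \<Rightarrow> real) \<Rightarrow> (real \<Rightarrow> real) \<Rightarrow> (real \<Rightarrow> real) \<Rightarrow> real \<times> real \<Rightarrow> real ^ 4" where
  "elliptic_rotational_surface x1 x2 r =
     (\<lambda>(u, v). vector [x1 u, x2 u, r u * cos v, r u * sin v])"

end

theory Submission
  imports Defs
begin

text \<open>
  In the frame \<open>z\<^sub>u\<close>, \<open>z\<^sub>v / r\<close> twice the mean curvature vector is
  \<open>(x\<^sub>1'' + r' x\<^sub>1' / r, x\<^sub>2'' + r' x\<^sub>2' / r, A cos v, A sin v)\<close> with
  \<open>A = (r r'' + r'\<^sup>2 + 1) / r\<close>. Resolving its first two components along \<open>(x\<^sub>1', x\<^sub>2')\<close> and
  orthogonally to it, one finds that the vector is lightlike iff \<open>A \<noteq> 0\<close> and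
  \<open>x\<^sub>1' x\<^sub>2'' - x\<^sub>2' x\<^sub>1'' = \<eta> A\<close> for a sign \<open>\<eta>\<close>. In polar form
  \<open>(x\<^sub>1', x\<^sub>2') = \<rho> (cos \<phi>, sin \<phi>)\<close>, where \<open>\<rho>\<^sup>2 = 1 + r'\<^sup>2\<close> by arc length, the left-hand side is
  \<open>\<rho>\<^sup>2 \<phi>'\<close>, which is the stated equation for \<open>\<phi>'\<close>.
\<close>

section \<open>Calculus of smooth maps\<close>

lemma times_differentiable_on_cong:
  assumes "open S" "\<And>x. x \<in> S \<Longrightarrow> f x = g x" "times_differentiable_on n f S"
  shows "times_differentiable_on n g S"
  using assms(2,3)
proof (induction n arbitrary: f g)
  case 0
  then show ?case by (simp cong: continuous_on_cong)
next
  case (Suc n)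
  have der: "(g has_derivative frechet_derivative f (at x)) (at x)" if "x \<in> S" for x
    using Suc.prems that assms(1) has_derivative_transform_within_open[of f _ x UNIV S g]
    by (simp add: frechet_derivative_works)
  then have "frechet_derivative f (at x) = frechet_derivative g (at x)" if "x \<in> S" for x
    using that frechet_derivative_at by blast
  then have "times_differentiable_on n (\<lambda>x. frechet_derivative g (at x) v) S" for v
    using Suc.prems Suc.IH[of "\<lambda>x. frechet_derivative f (at x) v"] by simp
  then show ?case using der by (auto simp: differentiable_def)
qed

text \<open>Lets a derivative be supplied by an explicit formula that is only known to be correct on
  \<open>S\<close>. All closure properties below are proved through this rule.\<close>

lemma times_differentiable_on_SucI:
  assumes "open S" "\<And>x. x \<in> S \<Longrightarrow> (f has_derivative f' x) (at x)"
    and "\<And>v. times_differentiable_on n (\<lambda>x. f' x v) S"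
  shows "times_differentiable_on (Suc n) f S"
proof -
  have "f' x = frechet_derivative f (at x)" if "x \<in> S" for x
    using that assms(2) frechet_derivative_at by blast
  then have "times_differentiable_on n (\<lambda>x. frechet_derivative f (at x) v) S" for v
    using times_differentiable_on_cong[OF assms(1) _ assms(3)[of v]] by simp
  then show ?thesis using assms(2) by (auto simp: differentiable_def)
qed

text \<open>The recursion asks for continuity only at order 0, so the base case rests on
  differentiable functions being continuous.\<close>

lemma times_differentiable_on_SucD:
  assumes "times_differentiable_on (Suc n) f S"
  shows "times_differentiable_on n f S"
  using assms
proof (induction n arbitrary: f)
  case 0
  then show ?case
    by (auto intro!: continuous_at_imp_continuous_on differentiable_imp_continuous_within)
next
  case (Suc n)
  then show ?case by simp
qed

lemma times_differentiable_on_has_derivative: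
  assumes "times_differentiable_on (Suc n) f S" "x \<in> S"
  shows "(f has_derivative frechet_derivative f (at x)) (at x)"
  using assms by (simp add: frechet_derivative_works)

lemma times_differentiable_on_subset:
  assumes "times_differentiable_on n f S" "T \<subseteq> S"
  shows "times_differentiable_on n f T"
  using assms by (induction n arbitrary: f) (auto intro: continuous_on_subset)

lemma times_differentiable_on_const: "times_differentiable_on n (\<lambda>x. c) S"
  by (induction n arbitrary: c) auto

lemma times_differentiable_on_bounded_linear:
  assumes "bounded_linear h"
  shows "times_differentiable_on n h S"
proof (cases n)
  case 0
  then show ?thesis using assms by (simp add: linear_continuous_on)
next
  case (Suc m)
  have "frechet_derivative h (at x) = h" for x
    using assms frechet_derivative_at[of h h x] bounded_linear_imp_has_derivative by metis
  then show ?thesis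
    using Suc assms by (simp add: times_differentiable_on_const bounded_linear_imp_differentiable)
qed

lemma times_differentiable_on_bounded_linear_comp:
  assumes "open S" "bounded_linear h" "times_differentiable_on n f S"
  shows "times_differentiable_on n (\<lambda>x. h (f x)) S"
  using assms(3)
proof (induction n arbitrary: f)
  case 0
  then show ?case using assms(2) by (simp add: bounded_linear.continuous_on)
next
  case (Suc n)
  show ?case
  proof (rule times_differentiable_on_SucI[OF assms(1)])
    show "((\<lambda>x. h (f x)) has_derivative (\<lambda>v. h (frechet_derivative f (at x) v))) (at x)"
      if "x \<in> S" for x
      using bounded_linear.has_derivative[OF assms(2)]
        times_differentiable_on_has_derivative[OF Suc.prems that] by blast
    show "times_differentiable_on n (\<lambda>x. h (frechet_derivative f (at x) v)) S" for v
      using Suc.prems by (intro Suc.IH) simp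
  qed
qed

lemma times_differentiable_on_add:
  assumes "open S" "times_differentiable_on n f S" "times_differentiable_on n g S"
  shows "times_differentiable_on n (\<lambda>x. f x + g x) S"
  using assms(2,3)
proof (induction n arbitrary: f g)
  case 0
  then show ?case by (simp add: continuous_on_add)
next
  case (Suc n)
  show ?case
  proof (rule times_differentiable_on_SucI[OF assms(1)])
    show "((\<lambda>x. f x + g x) has_derivative
        (\<lambda>v. frechet_derivative f (at x) v + frechet_derivative g (at x) v)) (at x)" if "x \<in> S" for x
      using Suc.prems that
      by (intro has_derivative_add) (blast intro: times_differentiable_on_has_derivative)+
    show "times_differentiable_on n
        (\<lambda>x. frechet_derivative f (at x) v + frechet_derivative g (at x) v) S" for v
      using Suc.prems by (intro Suc.IH) simp_all
  qed
qed

lemma times_differentiable_on_sum: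
  assumes "open S" "\<And>i. i \<in> A \<Longrightarrow> times_differentiable_on n (f i) S"
  shows "times_differentiable_on n (\<lambda>x. \<Sum>i\<in>A. f i x) S"
  using assms(2)
  by (induction A rule: infinite_finite_induct)
    (simp_all add: times_differentiable_on_const times_differentiable_on_add[OF assms(1)])

text \<open>By the product rule each summand of the derivative pairs an undifferentiated factor with
  a differentiated one; the former is brought down to order \<open>n\<close> by
  \<open>times_differentiable_on_SucD\<close>, so the induction hypothesis covers both.\<close>

lemma times_differentiable_on_bilinear:
  assumes "open S" "bounded_bilinear bil"
    and "times_differentiable_on n f S" "times_differentiable_on n g S"
  shows "times_differentiable_on n (\<lambda>x. bil (f x) (g x)) S"
  using assms(3,4)
proof (induction n arbitrary: f g)
  case 0
  then show ?case by (simp add: bounded_bilinear.continuous_on[OF assms(2)])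
next
  case (Suc n)
  show ?case
  proof (rule times_differentiable_on_SucI[OF assms(1)])
    show "((\<lambda>x. bil (f x) (g x)) has_derivative
        (\<lambda>v. bil (f x) (frechet_derivative g (at x) v) + bil (frechet_derivative f (at x) v) (g x)))
        (at x)" if "x \<in> S" for x
      using Suc.prems that
      by (intro bounded_bilinear.FDERIV[OF assms(2)]) (blast intro: times_differentiable_on_has_derivative)+
    show "times_differentiable_on n (\<lambda>x. bil (f x) (frechet_derivative g (at x) v)
        + bil (frechet_derivative f (at x) v) (g x)) S" for v
      using Suc.prems Suc.prems[THEN times_differentiable_on_SucD]
      by (intro times_differentiable_on_add[OF assms(1)] Suc.IH) simp_all
  qed
qed

lemmas times_differentiable_on_mult =
  times_differentiable_on_bilinear[OF _ bounded_bilinear_mult]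

text \<open>The map is the sum of its components times the standard basis vectors, and multiplying a
  component by a fixed vector is bounded linear.\<close>

lemma times_differentiable_on_vec:
  fixes f :: "'a::euclidean_space \<Rightarrow> real ^ 'n"
  assumes "open S" "\<And>i. times_differentiable_on n (\<lambda>x. f x $ i) S"
  shows "times_differentiable_on n f S"
proof -
  have "times_differentiable_on n (\<lambda>x. \<Sum>i\<in>UNIV. (f x $ i) *\<^sub>R (axis i 1 :: real ^ 'n)) S"
    by (intro times_differentiable_on_sum assms(1)
        times_differentiable_on_bounded_linear_comp[OF assms(1) bounded_linear_scaleR_left assms(2)])
  moreover have "(\<Sum>i\<in>UNIV. (f x $ i) *\<^sub>R axis i 1) = f x" for x
    using basis_expansion[of "f x"] by (simp add: scalar_mult_eq_scaleR)
  ultimately show ?thesis by (simp only:)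
qed

section \<open>Functions of one real variable: ordinary derivatives, antiderivatives and
  composition\<close>

lemma times_differentiable_on_real_SucI:
  fixes f :: "real \<Rightarrow> real"
  assumes "open S" "\<And>x. x \<in> S \<Longrightarrow> (f has_real_derivative f' x) (at x)"
    and "times_differentiable_on n f' S"
  shows "times_differentiable_on (Suc n) f S"
  using assms(2) times_differentiable_on_bounded_linear_comp[OF assms(1) bounded_linear_mult_left assms(3)]
  by (intro times_differentiable_on_SucI[OF assms(1), where f' = "\<lambda>x v. f' x * v"])
    (simp_all add: has_field_derivative_def)

lemma times_differentiable_on_antiderivative:
  fixes f :: "real \<Rightarrow> real"
  assumes "open I" "\<And>u. u \<in> I \<Longrightarrow> (f has_real_derivative f' u) (at u)"
    and "times_differentiable_on n f' I"
  shows "times_differentiable_on n f I"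
  using times_differentiable_on_SucD[OF times_differentiable_on_real_SucI[OF assms]] .

lemma times_differentiable_on_DERIV_deriv:
  fixes f :: "real \<Rightarrow> real"
  assumes "times_differentiable_on (Suc n) f S" "x \<in> S"
  shows "(f has_real_derivative deriv f x) (at x)"
  using assms by (auto simp: DERIV_deriv_iff_real_differentiable)

lemma times_differentiable_on_deriv:
  fixes f :: "real \<Rightarrow> real"
  assumes "open S" "times_differentiable_on (Suc n) f S"
  shows "times_differentiable_on n (deriv f) S"
proof (rule times_differentiable_on_cong[OF assms(1)])
  show "times_differentiable_on n (\<lambda>x. frechet_derivative f (at x) 1) S"
    using assms(2) by simp
  show "frechet_derivative f (at x) 1 = deriv f x" if "x \<in> S" for x
    using fun_cong[OF frechet_derivative_at[OF times_differentiable_on_DERIV_deriv[OF assms(2) that,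
            unfolded has_field_derivative_def]], of 1] by simp
qed

text \<open>The chain rule gives \<open>deriv h (f x)\<close> times a derivative of
  \<open>f\<close>. The first factor is again a composition, with \<open>deriv h\<close> as outer
  function and the same inner function, so the induction generalizes \<open>h\<close> alone.\<close>

lemma times_differentiable_on_compose:
  fixes h :: "real \<Rightarrow> real"
  assumes "open S" "open T" "times_differentiable_on n h T" "times_differentiable_on n f S" "f ` S \<subseteq> T"
  shows "times_differentiable_on n (\<lambda>x. h (f x)) S"
  using assms(3,4)
proof (induction n arbitrary: h)
  case 0
  then show ?case using assms(5) by (simp add: continuous_on_compose2)
next
  case (Suc n)
  show ?case
  proof (rule times_differentiable_on_SucI[OF assms(1)])
    show "((\<lambda>x. h (f x)) has_derivative (\<lambda>v. deriv h (f x) * frechet_derivative f (at x) v)) (at x)"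
      if "x \<in> S" for x
    proof -
      have "(h has_derivative (*) (deriv h (f x))) (at (f x))"
        using times_differentiable_on_DERIV_deriv[OF Suc.prems(1)] that assms(5)
        by (auto simp: has_field_derivative_def)
      from has_derivative_compose[OF times_differentiable_on_has_derivative[OF Suc.prems(2) that] this]
      show ?thesis .
    qed
    show "times_differentiable_on n (\<lambda>x. deriv h (f x) * frechet_derivative f (at x) v) S" for v
      using Suc.prems(2) Suc.IH[OF times_differentiable_on_deriv[OF assms(2) Suc.prems(1)]
          times_differentiable_on_SucD[OF Suc.prems(2)]]
      by (simp add: times_differentiable_on_mult[OF assms(1)])
  qed
qed

section \<open>Smoothness of elementary functions\<close>

lemma times_differentiable_on_minus:
  fixes f :: "'a::euclidean_space \<Rightarrow> real"
  assumes "open S" "times_differentiable_on n f S"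
  shows "times_differentiable_on n (\<lambda>x. - f x) S"
  using times_differentiable_on_bounded_linear_comp[OF assms(1) _ assms(2), of uminus]
  by (simp add: bounded_linear_minus bounded_linear_ident)

text \<open>Up to sign each function is the derivative of the other, so one induction must carry
  both.\<close>

lemma times_differentiable_on_sin_cos:
  "times_differentiable_on n (sin :: real \<Rightarrow> real) UNIV \<and>
   times_differentiable_on n (cos :: real \<Rightarrow> real) UNIV"
proof (induction n)
  case 0
  then show ?case by (simp add: continuous_on_sin continuous_on_cos continuous_on_id)
next
  case (Suc n)
  then show ?case
    using times_differentiable_on_minus[OF open_UNIV, of n "sin :: real \<Rightarrow> real"]
    using times_differentiable_on_real_SucI[OF open_UNIV DERIV_sin, of n]
      times_differentiable_on_real_SucI[OF open_UNIV DERIV_cos, of n] by blast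
qed

lemma times_differentiable_on_inverse:
  "times_differentiable_on n (inverse :: real \<Rightarrow> real) {0<..}"
proof (induction n)
  case 0
  then show ?case by (simp add: continuous_on_inverse continuous_on_id)
next
  case (Suc n)
  have "times_differentiable_on n (\<lambda>x. - (inverse x * inverse x) :: real) {0<..}"
    using Suc by (intro times_differentiable_on_minus times_differentiable_on_mult) auto
  then show ?case
    by (intro times_differentiable_on_real_SucI[where f' = "\<lambda>x. - (inverse x * inverse x)"])
      (auto intro!: derivative_eq_intros)
qed

text \<open>The derivative is written as \<open>sqrt x * (inverse x * (1/2))\<close> instead of with
  \<open>inverse (sqrt x)\<close>: its factors are then \<open>sqrt\<close>, covered by the
  induction hypothesis, and functions already known to be smooth.\<close>

lemma times_differentiable_on_sqrt:
  "times_differentiable_on n sqrt {0<..}"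
proof (induction n)
  case 0
  then show ?case by (simp add: continuous_on_real_sqrt continuous_on_id)
next
  case (Suc n)
  have "times_differentiable_on n (\<lambda>x. sqrt x * (inverse x * (1/2)) :: real) {0<..}"
    using Suc by (intro times_differentiable_on_mult times_differentiable_on_inverse
        times_differentiable_on_const) auto
  moreover have "(sqrt has_real_derivative sqrt x * (inverse x * (1/2))) (at x)" if "0 < x" for x
  proof -
    have "inverse (sqrt x) = sqrt x * inverse x"
      using that by (simp add: field_simps)
    then show ?thesis using DERIV_real_sqrt[OF that] by (simp add: mult.assoc)
  qed
  ultimately show ?case
    by (intro times_differentiable_on_real_SucI[where f' = "\<lambda>x. sqrt x * (inverse x * (1/2))"]) auto
qed

lemma times_differentiable_on_divide:
  fixes f g :: "'a::euclidean_space \<Rightarrow> real"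
  assumes "open S" "times_differentiable_on n f S" "times_differentiable_on n g S"
    and "\<And>x. x \<in> S \<Longrightarrow> g x > 0"
  shows "times_differentiable_on n (\<lambda>x. f x / g x) S"
proof -
  have "times_differentiable_on n (\<lambda>x. inverse (g x)) S"
    by (rule times_differentiable_on_compose[OF assms(1) _ times_differentiable_on_inverse assms(3)])
      (auto simp: assms(4))
  from times_differentiable_on_mult[OF assms(1,2) this] show ?thesis
    by (simp add: divide_inverse)
qed

lemma times_differentiable_on_power2:
  fixes f :: "'a::euclidean_space \<Rightarrow> real"
  assumes "open S" "times_differentiable_on n f S"
  shows "times_differentiable_on n (\<lambda>x. (f x)\<^sup>2) S"
  unfolding power2_eq_square by (rule times_differentiable_on_mult[OF assms(1) assms(2) assms(2)])

lemma smooth_on_open: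
  assumes "open S"
  shows "smooth_on S f \<longleftrightarrow> (\<forall>n. times_differentiable_on n f S)"
  unfolding smooth_on_def using assms times_differentiable_on_subset by blast

section \<open>Componentwise differentiation of maps into four-space\<close>

lemma vector_4 [simp]:
  "(vector [a, b, c, d] :: 'a::zero ^ 4) $ 1 = a" "(vector [a, b, c, d] :: 'a ^ 4) $ 2 = b"
  "(vector [a, b, c, d] :: 'a ^ 4) $ 3 = c" "(vector [a, b, c, d] :: 'a ^ 4) $ 4 = d"
  unfolding vector_def by simp_all

lemma has_derivative_vec:
  fixes f :: "'a::real_normed_vector \<Rightarrow> real ^ 'n"
  assumes "\<And>i. ((\<lambda>x. f x $ i) has_derivative (\<lambda>h. f' h $ i)) (at x)"
  shows "(f has_derivative f') (at x)"
  using assms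
  by (subst has_derivative_componentwise_within) (auto simp: Basis_vec_def inner_axis)

lemma has_derivative_fst_compose:
  assumes "(f has_real_derivative f') (at u)"
  shows "((\<lambda>p. f (fst p)) has_derivative (\<lambda>h. f' * fst h)) (at (u, v))"
proof -
  have "(f has_derivative (*) f') (at (fst (u, v)))"
    using assms by (simp add: has_field_derivative_def)
  from has_derivative_compose[OF has_derivative_fst[OF has_derivative_ident] this] show ?thesis by simp
qed

lemma has_derivative_fst_times_trig:
  assumes "(f has_real_derivative f') (at u)"
  shows "((\<lambda>p. f (fst p) * cos (snd p)) has_derivative
      (\<lambda>h. fst h * (f' * cos v) - snd h * (f u * sin v))) (at (u, v))"
    and "((\<lambda>p. f (fst p) * sin (snd p)) has_derivative
      (\<lambda>h. fst h * (f' * sin v) + snd h * (f u * cos v))) (at (u, v))"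
  by (rule has_derivative_eq_rhs,
      rule has_derivative_mult has_derivative_fst_compose[OF assms] has_derivative_cos
        has_derivative_sin has_derivative_snd has_derivative_ident,
      (rule has_derivative_fst_compose[OF assms] has_derivative_cos
        has_derivative_sin has_derivative_snd has_derivative_ident)+,
      simp add: fun_eq_iff algebra_simps)+

section \<open>Curvature of elliptic rotational surfaces\<close>

text \<open>This is the derivative of the surface in \<open>v\<close>. It is kept as a function of
  the profile so that \<open>deriv r\<close> in place of \<open>r\<close> gives the mixed second
  derivative.\<close>

definition rotation_field :: "(real \<Rightarrow> real) \<Rightarrow> real \<times> real \<Rightarrow> real ^ 4" where
  "rotation_field r = (\<lambda>(u, v). vector [0, 0, - (r u * sin v), r u * cos v])"

text \<open>The derivative in \<open>u\<close> has the same shape as the surface, with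
  differentiated profile functions, so the lemma applies again to yield second derivatives.\<close>

lemma has_derivative_elliptic_rotational_surface:
  assumes "(x1 has_real_derivative x1' u) (at u)" "(x2 has_real_derivative x2' u) (at u)"
    and "(r has_real_derivative r' u) (at u)"
  shows "(elliptic_rotational_surface x1 x2 r has_derivative
    (\<lambda>h. fst h *\<^sub>R elliptic_rotational_surface x1' x2' r' (u, v) + snd h *\<^sub>R rotation_field r (u, v)))
    (at (u, v))"
proof (rule has_derivative_vec)
  fix i :: 4
  let ?P = "\<lambda>i. ((\<lambda>p. elliptic_rotational_surface x1 x2 r p $ i) has_derivative
    (\<lambda>h. (fst h *\<^sub>R elliptic_rotational_surface x1' x2' r' (u, v)
      + snd h *\<^sub>R rotation_field r (u, v)) $ i)) (at (u, v))"
  have "\<forall>i. ?P i"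
    unfolding forall_4
    using assms[THEN has_derivative_fst_compose, of v]
      has_derivative_fst_times_trig[OF assms(3), of v]
      has_derivative_minus[OF has_derivative_fst_times_trig(2)[OF assms(3), of v]]
    by (simp add: elliptic_rotational_surface_def rotation_field_def case_prod_beta' mult.commute)
  then show "?P i" by blast
qed

lemma has_derivative_rotation_field:
  assumes "(r has_real_derivative r' u) (at u)"
  shows "(rotation_field r has_derivative
    (\<lambda>h. fst h *\<^sub>R rotation_field r' (u, v)
      + snd h *\<^sub>R vector [0, 0, - (r u * cos v), - (r u * sin v)])) (at (u, v))"
proof (rule has_derivative_vec)
  fix i :: 4
  let ?P = "\<lambda>i. ((\<lambda>p. rotation_field r p $ i) has_derivative
    (\<lambda>h. (fst h *\<^sub>R rotation_field r' (u, v)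
      + snd h *\<^sub>R vector [0, 0, - (r u * cos v), - (r u * sin v)]) $ i)) (at (u, v))"
  have "\<forall>i. ?P i"
    unfolding forall_4
    using assms[THEN has_derivative_fst_compose, of v]
      has_derivative_fst_times_trig[OF assms, of v]
      has_derivative_minus[OF has_derivative_fst_times_trig(2)[OF assms, of v]]
    by (simp add: rotation_field_def case_prod_beta' mult.commute)
  then show "?P i" by blast
qed

lemma ip_add_left: "ip (x + y) w = ip x w + ip y w"
  and ip_diff_left: "ip (x - y) w = ip x w - ip y w"
  and ip_add_right: "ip w (x + y) = ip w x + ip w y"
  and ip_scaleR_left: "ip (a *\<^sub>R x) w = a * ip x w"
  and ip_scaleR_right: "ip w (a *\<^sub>R x) = a * ip w x"
  by (simp_all add: ip_def algebra_simps)

lemmas ip_linear = ip_add_left ip_diff_left ip_add_right ip_scaleR_left ip_scaleR_right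

section \<open>Smoothness of the surface in both parameters\<close>

lemma times_differentiable_on_fst_compose:
  fixes f :: "real \<Rightarrow> real"
  assumes "open J" "times_differentiable_on n f J"
  shows "times_differentiable_on n (\<lambda>p. f (fst p)) (J \<times> (UNIV :: real set))"
  by (rule times_differentiable_on_compose[OF _ _ assms(2)
        times_differentiable_on_bounded_linear[OF bounded_linear_fst]])
    (auto simp: open_Times assms(1))

lemma times_differentiable_on_snd_compose:
  fixes f :: "real \<Rightarrow> real"
  assumes "open J" "times_differentiable_on n f UNIV"
  shows "times_differentiable_on n (\<lambda>p. f (snd p)) (J \<times> (UNIV :: real set))"
  by (rule times_differentiable_on_compose[OF _ _ assms(2)
        times_differentiable_on_bounded_linear[OF bounded_linear_snd]])
    (auto simp: open_Times assms(1))

lemma times_differentiable_on_elliptic_rotational_surface: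
  assumes "open J" "times_differentiable_on n x1 J" "times_differentiable_on n x2 J"
    and "times_differentiable_on n r J"
  shows "times_differentiable_on n (elliptic_rotational_surface x1 x2 r) (J \<times> UNIV)"
proof (rule times_differentiable_on_vec)
  show open_JU: "open (J \<times> (UNIV :: real set))" using assms(1) by (simp add: open_Times)
  note fst = assms(2-4)[THEN times_differentiable_on_fst_compose[OF assms(1)]]
  have "\<forall>i. times_differentiable_on n (\<lambda>p. elliptic_rotational_surface x1 x2 r p $ i) (J \<times> UNIV)"
    unfolding forall_4
    using fst times_differentiable_on_mult[OF open_JU fst(3)
        times_differentiable_on_snd_compose[OF assms(1), of n cos]]
      times_differentiable_on_mult[OF open_JU fst(3)
        times_differentiable_on_snd_compose[OF assms(1), of n sin]] times_differentiable_on_sin_cos[of n]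
    by (simp add: elliptic_rotational_surface_def case_prod_beta')
  then show "times_differentiable_on n (\<lambda>p. elliptic_rotational_surface x1 x2 r p $ i) (J \<times> UNIV)"
    for i by blast
qed

text \<open>This makes the mean curvature vector independent of the orthonormal frame.\<close>

lemma lorentz_transpose:
  fixes a b c d :: real
  assumes "a\<^sup>2 - b\<^sup>2 = 1" "c\<^sup>2 - d\<^sup>2 = -1" "a * c = b * d"
  shows "a\<^sup>2 - c\<^sup>2 = 1" "b\<^sup>2 - d\<^sup>2 = -1"
proof -
  have "a\<^sup>2 * c\<^sup>2 = b\<^sup>2 * d\<^sup>2"
    using assms(3) by (metis power_mult_distrib)
  moreover have "b\<^sup>2 = a\<^sup>2 - 1" "d\<^sup>2 = c\<^sup>2 + 1"
    using assms by simp_all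
  ultimately show "a\<^sup>2 - c\<^sup>2 = 1" "b\<^sup>2 - d\<^sup>2 = -1"
    by (simp_all add: algebra_simps)
qed

text \<open>This is what the last two coordinates contribute to \<open>ip\<close> for two vectors in
  the direction of angle \<open>v\<close>; it removes \<open>v\<close> from the inner products
  below.\<close>

lemma rotated_norm:
  "- (a * cos v * (b * cos v)) - a * sin v * (b * sin v) = - (a * b)" for a b v :: real
proof -
  have "- (a * cos v * (b * cos v)) - a * sin v * (b * sin v) = - (a * b) * ((cos v)\<^sup>2 + (sin v)\<^sup>2)"
    by algebra
  then show ?thesis by simp
qed

text \<open>The hypotheses on the curve in coordinates, shared by both directions: the direct part
  verifies them, the converse extracts them from the assumptions on
  \<open>generating_curve\<close>.\<close>

locale elliptic_profile =
  fixes J :: "real set" and x1 x2 r :: "real \<Rightarrow> real"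
  assumes open_J: "open J"
    and smooth_x1: "\<And>n. times_differentiable_on n x1 J"
    and smooth_x2: "\<And>n. times_differentiable_on n x2 J"
    and smooth_r: "\<And>n. times_differentiable_on n r J"
    and r_pos: "\<And>u. u \<in> J \<Longrightarrow> r u > 0"
    and unit_speed: "\<And>u. u \<in> J \<Longrightarrow> (deriv x1 u)\<^sup>2 + (deriv x2 u)\<^sup>2 - (deriv r u)\<^sup>2 = 1"
begin

abbreviation z where "z \<equiv> elliptic_rotational_surface x1 x2 r"
abbreviation z\<^sub>u where "z\<^sub>u \<equiv> elliptic_rotational_surface (deriv x1) (deriv x2) (deriv r)"
abbreviation z\<^sub>v where "z\<^sub>v \<equiv> rotation_field r"
abbreviation z\<^sub>u\<^sub>u where
  "z\<^sub>u\<^sub>u \<equiv> elliptic_rotational_surface (deriv (deriv x1)) (deriv (deriv x2)) (deriv (deriv r))"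
abbreviation z\<^sub>u\<^sub>v where "z\<^sub>u\<^sub>v \<equiv> rotation_field (deriv r)"
abbreviation z\<^sub>v\<^sub>v :: "real \<times> real \<Rightarrow> real ^ 4" where
  "z\<^sub>v\<^sub>v \<equiv> \<lambda>(u, v). vector [0, 0, - (r u * cos v), - (r u * sin v)]"

lemma derivs:
  assumes "u \<in> J"
  shows "(x1 has_real_derivative deriv x1 u) (at u)" "(x2 has_real_derivative deriv x2 u) (at u)"
    and "(r has_real_derivative deriv r u) (at u)"
    and "(deriv x1 has_real_derivative deriv (deriv x1) u) (at u)"
    and "(deriv x2 has_real_derivative deriv (deriv x2) u) (at u)"
    and "(deriv r has_real_derivative deriv (deriv r) u) (at u)"
  using assms smooth_x1 smooth_x2 smooth_r
    times_differentiable_on_deriv[OF open_J smooth_x1] times_differentiable_on_deriv[OF open_J smooth_x2]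
    times_differentiable_on_deriv[OF open_J smooth_r]
  by (blast intro: times_differentiable_on_DERIV_deriv)+

text \<open>Half the derivative of the unit speed identity, which holds throughout the open set
  \<open>J\<close>.\<close>

lemma acceleration_orthogonal:
  assumes "u \<in> J"
  shows "deriv x1 u * deriv (deriv x1) u + deriv x2 u * deriv (deriv x2) u
    - deriv r u * deriv (deriv r) u = 0"
proof -
  have "((\<lambda>u. (deriv x1 u)\<^sup>2 + (deriv x2 u)\<^sup>2 - (deriv r u)\<^sup>2) has_real_derivative
      2 * (deriv x1 u * deriv (deriv x1) u + deriv x2 u * deriv (deriv x2) u
        - deriv r u * deriv (deriv r) u)) (at u)"
    by (rule derivative_eq_intros derivs[OF assms] refl | simp add: algebra_simps)+
  moreover have "((\<lambda>u. (deriv x1 u)\<^sup>2 + (deriv x2 u)\<^sup>2 - (deriv r u)\<^sup>2) has_real_derivative 0) (at u)"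
    by (rule has_field_derivative_transform_within_open[OF DERIV_const[of 1] open_J assms])
      (simp add: unit_speed)
  ultimately show ?thesis using DERIV_unique by fastforce
qed

lemma frechet_derivative_z:
  assumes "p \<in> J \<times> UNIV"
  shows "frechet_derivative z (at p) = (\<lambda>h. fst h *\<^sub>R z\<^sub>u p + snd h *\<^sub>R z\<^sub>v p)"
  using has_derivative_elliptic_rotational_surface[where v = "snd p"] derivs[of "fst p"] assms
  by (cases p) (auto intro!: frechet_derivative_at[symmetric])

lemma tangent_space_z:
  assumes "p \<in> J \<times> UNIV"
  shows "tangent_space z p = {a *\<^sub>R z\<^sub>u p + b *\<^sub>R z\<^sub>v p | a b. True}"
  unfolding tangent_space_def frechet_derivative_z[OF assms] by (auto simp: image_iff; blast)

lemma tangent_field_z: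
  assumes "p \<in> J \<times> UNIV"
  shows "tangent_field z X p = fst (X p) *\<^sub>R z\<^sub>u p + snd (X p) *\<^sub>R z\<^sub>v p"
  by (simp add: tangent_field_def frechet_derivative_z[OF assms])

lemma first_fundamental_form:
  assumes "p \<in> J \<times> UNIV"
  shows "ip (z\<^sub>u p) (z\<^sub>u p) = 1" "ip (z\<^sub>u p) (z\<^sub>v p) = 0" "ip (z\<^sub>v p) (z\<^sub>u p) = 0"
    "ip (z\<^sub>v p) (z\<^sub>v p) = - (r (fst p))\<^sup>2"
proof -
  obtain u v where p: "p = (u, v)" "u \<in> J" using assms by auto
  show "ip (z\<^sub>u p) (z\<^sub>u p) = 1"
    using unit_speed[OF p(2)] rotated_norm[of "deriv r u" v "deriv r u"]
    by (simp add: p ip_def elliptic_rotational_surface_def power2_eq_square)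
  show "ip (z\<^sub>v p) (z\<^sub>v p) = - (r (fst p))\<^sup>2"
    using rotated_norm[of "r u" v "r u"]
    by (simp add: p ip_def rotation_field_def power2_eq_square)
qed (simp_all add: ip_def elliptic_rotational_surface_def rotation_field_def split: prod.split)

text \<open>Together with the first fundamental form these values say that
  \<open>z\<^sub>u\<^sub>u\<close> is already normal and that the tangential part of
  \<open>z\<^sub>v\<^sub>v\<close> is \<open>r r' z\<^sub>u\<close>.\<close>

lemma second_derivatives_ip:
  assumes "p \<in> J \<times> UNIV"
  shows "ip (z\<^sub>u\<^sub>u p) (z\<^sub>u p) = 0" "ip (z\<^sub>u\<^sub>u p) (z\<^sub>v p) = 0"
    "ip (z\<^sub>v\<^sub>v p) (z\<^sub>u p) = r (fst p) * deriv r (fst p)" "ip (z\<^sub>v\<^sub>v p) (z\<^sub>v p) = 0"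
proof -
  obtain u v where p: "p = (u, v)" "u \<in> J" using assms by auto
  show "ip (z\<^sub>u\<^sub>u p) (z\<^sub>u p) = 0"
    using acceleration_orthogonal[OF p(2)] rotated_norm[of "deriv (deriv r) u" v "deriv r u"]
    by (simp add: p ip_def elliptic_rotational_surface_def algebra_simps)
  show "ip (z\<^sub>v\<^sub>v p) (z\<^sub>u p) = r (fst p) * deriv r (fst p)"
    using rotated_norm[of "r u" v "deriv r u"]
    by (simp add: p ip_def elliptic_rotational_surface_def algebra_simps)
qed (simp_all add: ip_def elliptic_rotational_surface_def rotation_field_def split: prod.split)

text \<open>The Gram matrix of \<open>z\<^sub>u\<close>, \<open>z\<^sub>v\<close> is diagonal with
  entries \<open>1\<close> and \<open>- r\<^sup>2\<close>, so it is nondegenerate. This yields both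
  uniqueness of normal components and injectivity of the differential.\<close>

lemma tangent_coefficients:
  assumes "p \<in> J \<times> UNIV" "w = a *\<^sub>R z\<^sub>u p + b *\<^sub>R z\<^sub>v p" "ip w (z\<^sub>u p) = 0" "ip w (z\<^sub>v p) = 0"
  shows "a = 0" "b = 0"
  using assms r_pos[of "fst p"] first_fundamental_form[OF assms(1)]
  by (auto simp: ip_linear)

text \<open>Evaluates the definite description: any other candidate differs from \<open>n\<close> by
  a vector that is both tangent and normal, hence zero.\<close>

lemma normal_component_eq:
  assumes p: "p \<in> J \<times> UNIV" and n: "ip n (z\<^sub>u p) = 0" "ip n (z\<^sub>v p) = 0"
    and w: "w = n + a *\<^sub>R z\<^sub>u p + b *\<^sub>R z\<^sub>v p"
  shows "normal_component z p w = n"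
  unfolding normal_component_def
proof (rule the_equality)
  show "n \<in> normal_space z p \<and> w - n \<in> tangent_space z p"
    using n w by (auto simp: normal_space_def tangent_space_z[OF p] ip_linear)
next
  fix m
  assume m: "m \<in> normal_space z p \<and> w - m \<in> tangent_space z p"
  then obtain c d where cd: "w - m = c *\<^sub>R z\<^sub>u p + d *\<^sub>R z\<^sub>v p"
    by (auto simp: tangent_space_z[OF p])
  have "z\<^sub>u p \<in> tangent_space z p" "z\<^sub>v p \<in> tangent_space z p"
    unfolding tangent_space_z[OF p]
    by (force intro: exI[of _ 1] exI[of _ 0])+
  with m have "ip m (z\<^sub>u p) = 0" "ip m (z\<^sub>v p) = 0"
    by (auto simp: normal_space_def)
  then have "ip (n - m) (z\<^sub>u p) = 0" "ip (n - m) (z\<^sub>v p) = 0"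
    using n by (simp_all add: ip_linear)
  moreover have nm: "n - m = (c - a) *\<^sub>R z\<^sub>u p + (d - b) *\<^sub>R z\<^sub>v p"
    using cd w by (simp add: algebra_simps)
  ultimately have "c - a = 0" "d - b = 0"
    using tangent_coefficients[OF p nm] by blast+
  with nm show "m = n" by simp
qed

text \<open>Derivatives of the coefficients of \<open>X\<close> enter only through tangent terms,
  and so does \<open>z\<^sub>u\<^sub>v\<close>. What survives depends on \<open>X p\<close> alone
  and has no mixed term, which makes the comparison of frames easy.\<close>

lemma second_fundamental_form_z:
  assumes p: "p \<in> J \<times> UNIV" and X: "X differentiable (at p)"
  shows "second_fundamental_form z X X p =
    (fst (X p))\<^sup>2 *\<^sub>R z\<^sub>u\<^sub>u p
    + (snd (X p))\<^sup>2 *\<^sub>R (z\<^sub>v\<^sub>v p - (r (fst p) * deriv r (fst p)) *\<^sub>R z\<^sub>u p)"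
proof -
  obtain u v where uv: "p = (u, v)" "u \<in> J" using p by auto
  obtain X' where X': "(X has_derivative X') (at p)" using X by (auto simp: differentiable_def)
  let ?a = "fst (X p)" and ?b = "snd (X p)"
  have zu: "(z\<^sub>u has_derivative (\<lambda>h. fst h *\<^sub>R z\<^sub>u\<^sub>u p + snd h *\<^sub>R z\<^sub>u\<^sub>v p)) (at p)"
    unfolding uv by (intro has_derivative_elliptic_rotational_surface derivs uv)
  have zv: "(z\<^sub>v has_derivative (\<lambda>h. fst h *\<^sub>R z\<^sub>u\<^sub>v p + snd h *\<^sub>R z\<^sub>v\<^sub>v p)) (at p)"
    using has_derivative_rotation_field[of r "deriv r" u v] derivs uv by simp
  have "((\<lambda>q. fst (X q) *\<^sub>R z\<^sub>u q + snd (X q) *\<^sub>R z\<^sub>v q) has_derivative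
      (\<lambda>h. (?a *\<^sub>R (fst h *\<^sub>R z\<^sub>u\<^sub>u p + snd h *\<^sub>R z\<^sub>u\<^sub>v p) + fst (X' h) *\<^sub>R z\<^sub>u p)
         + (?b *\<^sub>R (fst h *\<^sub>R z\<^sub>u\<^sub>v p + snd h *\<^sub>R z\<^sub>v\<^sub>v p) + snd (X' h) *\<^sub>R z\<^sub>v p))) (at p)"
    by (intro has_derivative_add has_derivative_scaleR has_derivative_fst has_derivative_snd X' zu zv)
  then have "(tangent_field z X has_derivative
      (\<lambda>h. (?a *\<^sub>R (fst h *\<^sub>R z\<^sub>u\<^sub>u p + snd h *\<^sub>R z\<^sub>u\<^sub>v p) + fst (X' h) *\<^sub>R z\<^sub>u p)
         + (?b *\<^sub>R (fst h *\<^sub>R z\<^sub>u\<^sub>v p + snd h *\<^sub>R z\<^sub>v\<^sub>v p) + snd (X' h) *\<^sub>R z\<^sub>v p))) (at p)"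
    by (rule has_derivative_transform_within_open[OF _ _ p])
      (simp_all add: open_J open_Times tangent_field_z)
  from fun_cong[OF frechet_derivative_at[OF this], of "X p"]
  have flat: "flat_connection z X X p =
      (?a *\<^sub>R (?a *\<^sub>R z\<^sub>u\<^sub>u p + ?b *\<^sub>R z\<^sub>u\<^sub>v p) + fst (X' (X p)) *\<^sub>R z\<^sub>u p)
         + (?b *\<^sub>R (?a *\<^sub>R z\<^sub>u\<^sub>v p + ?b *\<^sub>R z\<^sub>v\<^sub>v p) + snd (X' (X p)) *\<^sub>R z\<^sub>v p)"
    by (simp add: flat_connection_def)
  \<comment> \<open>Rotation fields depend linearly on the profile, so the fields of
    \<open>deriv r\<close> and \<open>r\<close> are proportional.\<close>
  have uv_tangent: "z\<^sub>u\<^sub>v p = (deriv r u / r u) *\<^sub>R z\<^sub>v p"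
    using r_pos[OF uv(2)] by (simp add: vec_eq_iff forall_4 uv rotation_field_def)
  show ?thesis
    unfolding second_fundamental_form_def
  proof (rule normal_component_eq[OF p])
    \<comment> \<open>The tangent coefficients collect the derivatives of the coefficients of
      \<open>X\<close>, the tangential part of \<open>z\<^sub>v\<^sub>v\<close>, and the two equal
      contributions of \<open>z\<^sub>u\<^sub>v\<close>.\<close>
    show "flat_connection z X X p =
      ?a\<^sup>2 *\<^sub>R z\<^sub>u\<^sub>u p + ?b\<^sup>2 *\<^sub>R (z\<^sub>v\<^sub>v p - (r (fst p) * deriv r (fst p)) *\<^sub>R z\<^sub>u p)
      + (fst (X' (X p)) + ?b\<^sup>2 * (r (fst p) * deriv r (fst p))) *\<^sub>R z\<^sub>u p
      + (snd (X' (X p)) + 2 * ?a * ?b * (deriv r u / r u)) *\<^sub>R z\<^sub>v p"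
      unfolding flat uv_tangent
      by (simp add: scaleR_add_left scaleR_add_right scaleR_diff_right power2_eq_square)
        (simp add: algebra_simps flip: scaleR_add_left)
  qed (simp_all add: ip_linear second_derivatives_ip[OF p] first_fundamental_form[OF p])
qed

section \<open>The mean curvature vector\<close>

definition mean_curvature_formula :: "real \<times> real \<Rightarrow> real ^ 4" where
  "mean_curvature_formula p = (1 / 2) *\<^sub>R (z\<^sub>u\<^sub>u p
     - (1 / (r (fst p))\<^sup>2) *\<^sub>R (z\<^sub>v\<^sub>v p - (r (fst p) * deriv r (fst p)) *\<^sub>R z\<^sub>u p))"

text \<open>Only squares of frame coefficients occur in \<open>second_fundamental_form_z\<close>. In
  the difference over the frame they appear as \<open>a\<^sup>2 - c\<^sup>2\<close> and
  \<open>b\<^sup>2 - d\<^sup>2\<close>, which \<open>lorentz_transpose\<close> determines.\<close>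

lemma mean_curvature_frame:
  assumes "open W" "p \<in> W" "orthonormal_frame_on W z X Y" and p: "p \<in> J \<times> UNIV"
  shows "(1 / 2) *\<^sub>R (second_fundamental_form z X X p - second_fundamental_form z Y Y p)
    = mean_curvature_formula p"
proof -
  have diff: "X differentiable (at p)" "Y differentiable (at p)"
    using assms(2,3) unfolding orthonormal_frame_on_def smooth_on_def
    by (metis subsetD times_differentiable_on.simps(2))+
  let ?r = "r (fst p)"
  have r: "?r > 0" using p r_pos by auto
  let ?a = "fst (X p)" and ?b = "snd (X p)" and ?c = "fst (Y p)" and ?d = "snd (Y p)"
  \<comment> \<open>Relative to the orthonormal pair \<open>z\<^sub>u\<close>,
    \<open>z\<^sub>v / r\<close> the frame has coordinates \<open>(a, r b)\<close> and
    \<open>(c, r d)\<close>; these are its orthonormality relations.\<close>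
  have "?a\<^sup>2 - (?r * ?b)\<^sup>2 = 1" "?c\<^sup>2 - (?r * ?d)\<^sup>2 = -1" "?a * ?c = (?r * ?b) * (?r * ?d)"
    using assms(2,3)
    by (auto simp: orthonormal_frame_on_def tangent_field_z[OF p] ip_linear
        first_fundamental_form[OF p] power2_eq_square algebra_simps dest!: bspec[of _ _ p])
  from lorentz_transpose[OF this] r
  have ac: "?a\<^sup>2 = 1 + ?c\<^sup>2" and bd: "?b\<^sup>2 = ?d\<^sup>2 - 1 / ?r\<^sup>2"
    by (simp_all add: field_simps)
  show ?thesis
    unfolding second_fundamental_form_z[OF p diff(1)] second_fundamental_form_z[OF p diff(2)]
      mean_curvature_formula_def ac bd
    by (simp add: scaleR_add_left scaleR_diff_left)
qed

text \<open>Supplies the existence half of the definite description in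
  \<open>mean_curvature\<close>, and also the vectors of signature \<open>(1,1)\<close> required of
  a Lorentz surface.\<close>

lemma orthonormal_frame_coordinates:
  "orthonormal_frame_on (J \<times> UNIV) z (\<lambda>p. (1, 0)) (\<lambda>p. (0, inverse (r (fst p))))"
  unfolding orthonormal_frame_on_def
proof (intro conjI ballI)
  have op: "open (J \<times> (UNIV :: real set))" using open_J by (simp add: open_Times)
  show "smooth_on (J \<times> UNIV) (\<lambda>p :: real \<times> real. (1 :: real, 0 :: real))"
    using op times_differentiable_on_const unfolding smooth_on_def by blast
  have "times_differentiable_on n (\<lambda>p. inverse (r (fst p))) (J \<times> (UNIV :: real set))" for n
    by (rule times_differentiable_on_compose[OF op _ times_differentiable_on_inverse
          times_differentiable_on_fst_compose[OF open_J smooth_r]]) (auto simp: r_pos)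
  moreover have "bounded_linear (\<lambda>y :: real. (0 :: real, y))"
    by (intro bounded_linear_Pair bounded_linear_zero bounded_linear_ident)
  ultimately have "times_differentiable_on n (\<lambda>p. (0 :: real, inverse (r (fst p)))) (J \<times> (UNIV :: real set))"
    for n
    using times_differentiable_on_bounded_linear_comp[OF op] by fast
  then show "smooth_on (J \<times> UNIV) (\<lambda>p :: real \<times> real. (0 :: real, inverse (r (fst p))))"
    using op unfolding smooth_on_def by blast
next
  fix q assume q: "q \<in> J \<times> (UNIV :: real set)"
  then have "r (fst q) > 0" using r_pos by auto
  then show
    "ip (tangent_field z (\<lambda>p. (0, inverse (r (fst p)))) q)
        (tangent_field z (\<lambda>p. (0, inverse (r (fst p)))) q) = -1"
    by (simp add: tangent_field_z[OF q] ip_linear first_fundamental_form[OF q] power2_eq_square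
        field_simps)
qed (simp_all add: tangent_field_z ip_linear first_fundamental_form)

lemma mean_curvature_z:
  assumes p: "p \<in> J \<times> UNIV"
  shows "mean_curvature z p = mean_curvature_formula p"
  unfolding mean_curvature_def
proof (rule the_equality)
  show "\<exists>W X Y. open W \<and> p \<in> W \<and> orthonormal_frame_on W z X Y \<and> mean_curvature_formula p =
      (1 / 2) *\<^sub>R (second_fundamental_form z X X p - second_fundamental_form z Y Y p)"
    using p open_J mean_curvature_frame[OF _ p orthonormal_frame_coordinates p]
      orthonormal_frame_coordinates open_Times[OF open_J open_UNIV] by metis
qed (use mean_curvature_frame p in blast)

lemma lorentz_surface_z: "lorentz_surface (J \<times> {0..<2 * pi}) z"
  unfolding lorentz_surface_def
proof (intro conjI ballI)
  show "smooth_on (J \<times> {0..<2 * pi}) z"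
    unfolding smooth_on_def
    using open_Times[OF open_J open_UNIV]
      times_differentiable_on_elliptic_rotational_surface[OF open_J smooth_x1 smooth_x2 smooth_r]
    by (intro exI[of _ "J \<times> UNIV"]) auto
next
  fix p assume "p \<in> J \<times> {0..<2 * pi}"
  then have p: "p \<in> J \<times> UNIV" by auto
  show "inj (frechet_derivative z (at p))"
  proof (rule injI)
    fix h k assume "frechet_derivative z (at p) h = frechet_derivative z (at p) k"
    \<comment> \<open>The zero vector is written as a tangent combination; being orthogonal to
      everything, it satisfies the premises of \<open>tangent_coefficients\<close>.\<close>
    then have "0 = (fst h - fst k) *\<^sub>R z\<^sub>u p + (snd h - snd k) *\<^sub>R z\<^sub>v p"
      by (simp add: frechet_derivative_z[OF p] algebra_simps)
    from tangent_coefficients[OF p this] show "h = k"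
      by (simp add: ip_def prod_eq_iff)
  qed
  have "p \<in> J \<times> UNIV \<Longrightarrow> tangent_field z X p \<in> tangent_space z p" for X
    by (simp add: tangent_field_def tangent_space_def)
  then show "\<exists>e\<in>tangent_space z p. \<exists>f\<in>tangent_space z p. ip e e = 1 \<and> ip f f = - 1 \<and> ip e f = 0"
    using orthonormal_frame_coordinates p unfolding orthonormal_frame_on_def by blast
qed

text \<open>The criterion does not involve \<open>v\<close>: rotating the last two coordinates
  changes neither the norm of the mean curvature vector nor whether it vanishes.\<close>

lemma lightlike_mean_curvature_iff:
  assumes u: "u \<in> J"
  shows "lightlike (mean_curvature z (u, v)) \<longleftrightarrow>
    r u * deriv (deriv r) u + (deriv r u)\<^sup>2 + 1 \<noteq> 0 \<and>
    (r u * (deriv x1 u * deriv (deriv x2) u - deriv x2 u * deriv (deriv x1) u))\<^sup>2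
      = (r u * deriv (deriv r) u + (deriv r u)\<^sup>2 + 1)\<^sup>2"
proof -
  define R P Q P' Q' R' R'' where defs: "R = r u" "P = deriv x1 u" "Q = deriv x2 u"
    "P' = deriv (deriv x1) u" "Q' = deriv (deriv x2) u" "R' = deriv r u" "R'' = deriv (deriv r) u"
  \<comment> \<open>\<open>B\<close>, \<open>C\<close>, \<open>A\<close> describe
    \<open>2 r H\<close>, so this \<open>A\<close> is \<open>r\<close> times the quantity of the
    same name in the overview; no denominators remain.\<close>
  define A where "A = R * R'' + R'\<^sup>2 + 1"
  define B where "B = R * P' + R' * P"
  define C where "C = R * Q' + R' * Q"
  have R: "R > 0" using r_pos[OF u] by (simp add: defs)
  have unit: "P\<^sup>2 + Q\<^sup>2 = 1 + R'\<^sup>2" using unit_speed[OF u] by (simp add: defs)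
  have acc: "P * P' + Q * Q' = R' * R''" using acceleration_orthogonal[OF u] by (simp add: defs)
  let ?V = "vector [B, C, A * cos v, A * sin v] :: real ^ 4"
  have "mean_curvature_formula (u, v) = (1 / (2 * R)) *\<^sub>R ?V"
    using R
    by (simp add: mean_curvature_formula_def vec_eq_iff forall_4
        elliptic_rotational_surface_def A_def B_def C_def flip: defs)
      (simp add: field_simps power2_eq_square)
  then have H: "mean_curvature z (u, v) = (1 / (2 * R)) *\<^sub>R ?V"
    using u by (simp add: mean_curvature_z)
  have "ip ?V ?V = B\<^sup>2 + C\<^sup>2 - A\<^sup>2"
    using rotated_norm[of A v A] by (simp add: ip_def power2_eq_square)
  then have norm: "ip (mean_curvature z (u, v)) (mean_curvature z (u, v)) = 0 \<longleftrightarrow> B\<^sup>2 + C\<^sup>2 = A\<^sup>2"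
    using R by (simp add: H ip_linear)
  have zero: "mean_curvature z (u, v) = 0 \<longleftrightarrow> A = 0 \<and> B = 0 \<and> C = 0"
  proof -
    have "A * cos v = 0 \<and> A * sin v = 0 \<longleftrightarrow> A = 0"
      using sin_zero_abs_cos_one[of v] by auto
    then show ?thesis using R by (auto simp: H vec_eq_iff forall_4)
  qed
  have PB: "P * B + Q * C = R' * A"
  proof -
    have "P * B + Q * C = R * (P * P' + Q * Q') + R' * (P\<^sup>2 + Q\<^sup>2)"
      by (simp add: B_def C_def algebra_simps power2_eq_square)
    also have "\<dots> = R' * A"
      unfolding acc unit A_def by (simp add: algebra_simps)
    finally show ?thesis .
  qed
  \<comment> \<open>Lagrange's identity for \<open>(P, Q)\<close> and \<open>(B, C)\<close>; in
    \<open>P * C - Q * B\<close> the terms with \<open>R'\<close> cancel.\<close>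
  have "(1 + R'\<^sup>2) * (B\<^sup>2 + C\<^sup>2) = (P * B + Q * C)\<^sup>2 + (R * (P * Q' - Q * P'))\<^sup>2"
    unfolding unit[symmetric] B_def C_def by algebra
  then have "(1 + R'\<^sup>2) * (B\<^sup>2 + C\<^sup>2 - A\<^sup>2) = (R * (P * Q' - Q * P'))\<^sup>2 - A\<^sup>2"
    unfolding PB by (simp add: algebra_simps power_mult_distrib)
  moreover have "1 + R'\<^sup>2 \<noteq> 0" by (simp add: add_nonneg_eq_0_iff)
  ultimately have "B\<^sup>2 + C\<^sup>2 = A\<^sup>2 \<longleftrightarrow> (R * (P * Q' - Q * P'))\<^sup>2 = A\<^sup>2"
    by (metis eq_iff_diff_eq_0 mult_eq_0_iff)
  \<comment> \<open>A null vector with \<open>A = 0\<close> is therefore zero, so among null vectors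
    nonvanishing means exactly \<open>A \<noteq> 0\<close>.\<close>
  moreover have "B = 0 \<and> C = 0" if "A = 0" "B\<^sup>2 + C\<^sup>2 = A\<^sup>2"
    using that by simp
  ultimately show ?thesis
    unfolding lightlike_def norm zero by (auto simp: A_def defs)
qed

end

section \<open>The angle of the generating curve\<close>

lemma generating_curve_has_vector_derivative:
  assumes "(x1 has_real_derivative a) (at u)" "(x2 has_real_derivative b) (at u)"
    and "(r has_real_derivative c) (at u)"
  shows "(generating_curve x1 x2 r has_vector_derivative vector [a, b, c, 0]) (at u)"
  unfolding has_vector_derivative_def
proof (rule has_derivative_vec)
  have "\<forall>i. ((\<lambda>u. generating_curve x1 x2 r u $ i) has_derivative
      (\<lambda>h. (h *\<^sub>R vector [a, b, c, 0] :: real ^ 4) $ i)) (at u)"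
    unfolding forall_4 using assms
    by (simp add: generating_curve_def has_field_derivative_def mult_commute_abs)
  then show "((\<lambda>u. generating_curve x1 x2 r u $ i) has_derivative
      (\<lambda>h. (h *\<^sub>R vector [a, b, c, 0] :: real ^ 4) $ i)) (at u)" for i
    by blast
qed

lemma ip_velocity_generating_curve:
  assumes "(x1 has_real_derivative a) (at u)" "(x2 has_real_derivative b) (at u)"
    and "(r has_real_derivative c) (at u)"
  shows "ip (vector_derivative (generating_curve x1 x2 r) (at u))
    (vector_derivative (generating_curve x1 x2 r) (at u)) = a\<^sup>2 + b\<^sup>2 - c\<^sup>2"
  using vector_derivative_at[OF generating_curve_has_vector_derivative[OF assms]]
  by (simp add: ip_def power2_eq_square)

lemma times_differentiable_on_generating_curve_iff:
  assumes "open J"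
  shows "times_differentiable_on n (generating_curve x1 x2 r) J \<longleftrightarrow>
    times_differentiable_on n x1 J \<and> times_differentiable_on n x2 J \<and> times_differentiable_on n r J"
    (is "?L \<longleftrightarrow> ?R")
proof
  assume L: ?L
  have "times_differentiable_on n (\<lambda>u. generating_curve x1 x2 r u $ i) J" for i
    using times_differentiable_on_bounded_linear_comp[OF assms bounded_linear_vec_nth L] .
  from this[of 1] this[of 2] this[of 3] show ?R by (simp add: generating_curve_def)
next
  assume R: ?R
  have "\<forall>i. times_differentiable_on n (\<lambda>u. generating_curve x1 x2 r u $ i) J"
    unfolding forall_4 using R by (simp add: generating_curve_def times_differentiable_on_const)
  then show ?L using times_differentiable_on_vec[OF assms] by blast
qed

section \<open>From a prescribed angle to a quasi-minimal surface\<close>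

definition angle_rate :: "real \<Rightarrow> (real \<Rightarrow> real) \<Rightarrow> real \<Rightarrow> real" where
  "angle_rate \<eta> r u =
    \<eta> * ((r u * deriv (deriv r) u + (deriv r u)\<^sup>2 + 1) / (r u * (1 + (deriv r u)\<^sup>2)))"

lemma one_plus_square_pos [simp]: "0 < 1 + x\<^sup>2" for x :: real
  by (simp add: add_pos_nonneg)

lemma times_differentiable_on_angle_rate:
  assumes I: "open I" and r: "\<And>n. times_differentiable_on n r I" and pos: "\<And>u. u \<in> I \<Longrightarrow> r u > 0"
  shows "times_differentiable_on n (angle_rate \<eta> r) I"
proof -
  note r' = times_differentiable_on_deriv[OF I r]
  note r'' = times_differentiable_on_deriv[OF I r']
  show ?thesis
    unfolding angle_rate_def[abs_def]
    using pos
    by (intro times_differentiable_on_mult[OF I] times_differentiable_on_divide[OF I]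
        times_differentiable_on_add[OF I] times_differentiable_on_power2[OF I]
        times_differentiable_on_const r r' r'') simp
qed

lemma times_differentiable_on_horizontal_speed:
  assumes I: "open I" and r: "\<And>n. times_differentiable_on n r I"
  shows "times_differentiable_on n (\<lambda>u. sqrt (1 + (deriv r u)\<^sup>2)) I"
proof -
  have "times_differentiable_on n (\<lambda>u. 1 + (deriv r u)\<^sup>2) I"
    by (intro times_differentiable_on_add[OF I] times_differentiable_on_power2[OF I]
        times_differentiable_on_const times_differentiable_on_deriv[OF I r])
  from times_differentiable_on_compose[OF I open_greaterThan times_differentiable_on_sqrt this]
  show ?thesis by (simp add: image_subset_iff)
qed

text \<open>With \<open>\<rho>\<close> the planar speed, the polar form of the velocity gives
  \<open>x\<^sub>1' x\<^sub>2'' - x\<^sub>2' x\<^sub>1'' = \<rho>\<^sup>2 \<phi>'\<close>. The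
  prescribed rate turns \<open>r\<close> times this into \<eta> times the quantity assumed nonzero,
  and squaring removes the sign.\<close>

lemma quasi_minimal_of_angle:
  assumes I: "open I"
    and r_smooth: "smooth_on I r" and pos: "\<And>u. u \<in> I \<Longrightarrow> r u > 0"
    and nz: "\<And>u. u \<in> I \<Longrightarrow> r u * deriv (deriv r) u + (deriv r u)\<^sup>2 + 1 \<noteq> 0"
    and eta: "\<eta> \<in> {1, -1}"
    and phi: "\<And>u. u \<in> I \<Longrightarrow> (\<phi> has_real_derivative angle_rate \<eta> r u) (at u)"
    and x1: "\<And>u. u \<in> I \<Longrightarrow> (x1 has_real_derivative sqrt (1 + (deriv r u)\<^sup>2) * cos (\<phi> u)) (at u)"
    and x2: "\<And>u. u \<in> I \<Longrightarrow> (x2 has_real_derivative sqrt (1 + (deriv r u)\<^sup>2) * sin (\<phi> u)) (at u)"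
  shows "spacelike_curve I (generating_curve x1 x2 r)"
    and "arc_length_parameterized I (generating_curve x1 x2 r)"
    and "quasi_minimal (I \<times> {0..<2 * pi}) (elliptic_rotational_surface x1 x2 r)"
proof -
  define \<rho> where "\<rho> = (\<lambda>u. sqrt (1 + (deriv r u)\<^sup>2))"
  have r: "times_differentiable_on n r I" for n
    using r_smooth smooth_on_open[OF I] by blast
  have rho: "times_differentiable_on n \<rho> I" for n
    unfolding \<rho>_def by (rule times_differentiable_on_horizontal_speed[OF I r])
  \<comment> \<open>The angle and then \<open>x1\<close>, \<open>x2\<close> are given only as
    antiderivatives; smoothness passes from the integrands to them in this order.\<close>
  have phi_smooth: "times_differentiable_on n \<phi> I" for n
    by (rule times_differentiable_on_antiderivative[OF I phi
          times_differentiable_on_angle_rate[OF I r pos]])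
  have trig: "times_differentiable_on n (\<lambda>u. cos (\<phi> u)) I" "times_differentiable_on n (\<lambda>u. sin (\<phi> u)) I"
    for n
    using times_differentiable_on_compose[OF I open_UNIV _ phi_smooth] times_differentiable_on_sin_cos
    by blast+
  note x = x1[folded \<rho>_def[THEN fun_cong]] x2[folded \<rho>_def[THEN fun_cong]]
  have x1_smooth: "times_differentiable_on n x1 I" for n
    by (rule times_differentiable_on_antiderivative[OF I x(1)
          times_differentiable_on_mult[OF I rho trig(1)]])
  have x2_smooth: "times_differentiable_on n x2 I" for n
    by (rule times_differentiable_on_antiderivative[OF I x(2)
          times_differentiable_on_mult[OF I rho trig(2)]])
  have rho_sq: "(\<rho> u)\<^sup>2 = 1 + (deriv r u)\<^sup>2" for u
    by (simp add: \<rho>_def add_nonneg_nonneg)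
  have dx: "deriv x1 u = \<rho> u * cos (\<phi> u)" "deriv x2 u = \<rho> u * sin (\<phi> u)" if "u \<in> I" for u
    using x that DERIV_imp_deriv by blast+
  have unit: "(deriv x1 u)\<^sup>2 + (deriv x2 u)\<^sup>2 - (deriv r u)\<^sup>2 = 1" if "u \<in> I" for u
  proof -
    have "(deriv x1 u)\<^sup>2 + (deriv x2 u)\<^sup>2 = (\<rho> u)\<^sup>2 * ((sin (\<phi> u))\<^sup>2 + (cos (\<phi> u))\<^sup>2)"
      unfolding dx[OF that] by algebra
    then show ?thesis by (simp add: rho_sq)
  qed
  interpret elliptic_profile I x1 x2 r
    by unfold_locales (fact I x1_smooth x2_smooth r pos unit)+
  have ip: "ip (vector_derivative (generating_curve x1 x2 r) (at u))
      (vector_derivative (generating_curve x1 x2 r) (at u)) = 1" if "u \<in> I" for u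
    using ip_velocity_generating_curve[OF derivs(1-3)[OF that]] unit[OF that] by simp
  then show "spacelike_curve I (generating_curve x1 x2 r)"
    and "arc_length_parameterized I (generating_curve x1 x2 r)"
    using times_differentiable_on_generating_curve_iff[OF I] x1_smooth x2_smooth r
    by (auto simp: spacelike_curve_def arc_length_parameterized_def spacelike_def smooth_on_open[OF I])
  have "(r u * (deriv x1 u * deriv (deriv x2) u - deriv x2 u * deriv (deriv x1) u))\<^sup>2
      = (r u * deriv (deriv r) u + (deriv r u)\<^sup>2 + 1)\<^sup>2" if u: "u \<in> I" for u
  proof -
    let ?A = "r u * deriv (deriv r) u + (deriv r u)\<^sup>2 + 1"
    note d = times_differentiable_on_DERIV_deriv[OF rho u] phi[OF u]
    have "((\<lambda>u. \<rho> u * cos (\<phi> u)) has_real_derivative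
        deriv \<rho> u * cos (\<phi> u) - \<rho> u * sin (\<phi> u) * angle_rate \<eta> r u) (at u)"
      by (rule derivative_eq_intros d refl | simp)+
    \<comment> \<open>The formula for \<open>deriv x1\<close> is known on \<open>I\<close> only, so
      its derivative is transferred by openness of \<open>I\<close>.\<close>
    then have "(deriv x1 has_real_derivative
        deriv \<rho> u * cos (\<phi> u) - \<rho> u * sin (\<phi> u) * angle_rate \<eta> r u) (at u)"
      by (rule has_field_derivative_transform_within_open[OF _ I u]) (simp add: dx)
    then have d1: "deriv (deriv x1) u = deriv \<rho> u * cos (\<phi> u) - \<rho> u * sin (\<phi> u) * angle_rate \<eta> r u"
      by (rule DERIV_imp_deriv)
    have "((\<lambda>u. \<rho> u * sin (\<phi> u)) has_real_derivative
        deriv \<rho> u * sin (\<phi> u) + \<rho> u * cos (\<phi> u) * angle_rate \<eta> r u) (at u)"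
      by (rule derivative_eq_intros d refl | simp)+
    then have "(deriv x2 has_real_derivative
        deriv \<rho> u * sin (\<phi> u) + \<rho> u * cos (\<phi> u) * angle_rate \<eta> r u) (at u)"
      by (rule has_field_derivative_transform_within_open[OF _ I u]) (simp add: dx)
    then have d2: "deriv (deriv x2) u = deriv \<rho> u * sin (\<phi> u) + \<rho> u * cos (\<phi> u) * angle_rate \<eta> r u"
      by (rule DERIV_imp_deriv)
    have "deriv x1 u * deriv (deriv x2) u - deriv x2 u * deriv (deriv x1) u
        = (\<rho> u)\<^sup>2 * angle_rate \<eta> r u * ((sin (\<phi> u))\<^sup>2 + (cos (\<phi> u))\<^sup>2)"
      unfolding d1 d2 dx[OF u] by algebra
    also have "\<dots> = \<eta> * ?A / r u"
      using less_imp_neq[OF one_plus_square_pos[of "deriv r u"]] by (simp add: rho_sq angle_rate_def)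
    finally have "r u * (deriv x1 u * deriv (deriv x2) u - deriv x2 u * deriv (deriv x1) u) = \<eta> * ?A"
      using pos[OF u] by simp
    moreover have "\<eta>\<^sup>2 = 1" using eta by auto
    ultimately show ?thesis by (metis mult_1 power_mult_distrib)
  qed
  then show "quasi_minimal (I \<times> {0..<2 * pi}) (elliptic_rotational_surface x1 x2 r)"
    using nz by (auto simp: quasi_minimal_def lorentz_surface_z lightlike_mean_curvature_iff)
qed

section \<open>Recovering the angle from a quasi-minimal surface\<close>

text \<open>Rotate \<open>(P, Q)\<close> by the angle \<open>-\<phi>\<close>. As \<phi> turns at the
  angular rate of the curve, the rotated vector \<open>(C, S)\<close> keeps its direction, and at
  \<open>u0\<close> it lies on the positive first axis. Thus \<phi> is a polar angle throughout,
  with no branch of the argument to choose.\<close>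

lemma polar_form_of_angle:
  fixes P Q \<phi> :: "real \<Rightarrow> real"
  assumes u0: "u0 \<in> {a<..<b}"
    and P: "\<And>u. u \<in> {a<..<b} \<Longrightarrow> (P has_real_derivative P' u) (at u)"
    and Q: "\<And>u. u \<in> {a<..<b} \<Longrightarrow> (Q has_real_derivative Q' u) (at u)"
    and \<phi>: "\<And>u. u \<in> {a<..<b} \<Longrightarrow> (\<phi> has_real_derivative \<phi>' u) (at u)"
    and pos: "\<And>u. u \<in> {a<..<b} \<Longrightarrow> (P u)\<^sup>2 + (Q u)\<^sup>2 > 0"
    and rate: "\<And>u. u \<in> {a<..<b} \<Longrightarrow> ((P u)\<^sup>2 + (Q u)\<^sup>2) * \<phi>' u = P u * Q' u - Q u * P' u"
    and P0: "P u0 = sqrt ((P u0)\<^sup>2 + (Q u0)\<^sup>2) * cos (\<phi> u0)"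
    and Q0: "Q u0 = sqrt ((P u0)\<^sup>2 + (Q u0)\<^sup>2) * sin (\<phi> u0)"
    and u: "u \<in> {a<..<b}"
  shows "P u = sqrt ((P u)\<^sup>2 + (Q u)\<^sup>2) * cos (\<phi> u)" "Q u = sqrt ((P u)\<^sup>2 + (Q u)\<^sup>2) * sin (\<phi> u)"
proof -
  define \<rho> where "\<rho> = (\<lambda>u. sqrt ((P u)\<^sup>2 + (Q u)\<^sup>2))"
  define m where "m = (\<lambda>u. (P u * P' u + Q u * Q' u) / (\<rho> u)\<^sup>2)"
  define C where "C = (\<lambda>u. P u * cos (\<phi> u) + Q u * sin (\<phi> u))"
  define S where "S = (\<lambda>u. Q u * cos (\<phi> u) - P u * sin (\<phi> u))"
  have rho: "\<rho> u > 0" "(\<rho> u)\<^sup>2 = (P u)\<^sup>2 + (Q u)\<^sup>2" if "u \<in> {a<..<b}" for u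
    using pos[OF that] by (simp_all add: \<rho>_def)
  \<comment> \<open>\<open>\<rho>\<close>, \<open>C\<close> and \<open>S\<close> all solve \<open>f' = m f\<close>, so the quotients \<open>C / \<rho>\<close> and \<open>S / \<rho>\<close> are constant.\<close>
  have PQ: "P' u = m u * P u - Q u * \<phi>' u" "Q' u = m u * Q u + P u * \<phi>' u" if "u \<in> {a<..<b}" for u
  proof -
    have nz: "(\<rho> u)\<^sup>2 \<noteq> 0" using rho(1)[OF that] by simp
    have m: "(\<rho> u)\<^sup>2 * m u = P u * P' u + Q u * Q' u" using nz by (simp add: m_def)
    have k: "(\<rho> u)\<^sup>2 * \<phi>' u = P u * Q' u - Q u * P' u" using rate[OF that] rho[OF that] by simp
    have "(\<rho> u)\<^sup>2 * P' u = (\<rho> u)\<^sup>2 * (m u * P u - Q u * \<phi>' u)"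
      using m k rho(2)[OF that] by algebra
    then show "P' u = m u * P u - Q u * \<phi>' u" using nz by simp
    have "(\<rho> u)\<^sup>2 * Q' u = (\<rho> u)\<^sup>2 * (m u * Q u + P u * \<phi>' u)"
      using m k rho(2)[OF that] by algebra
    then show "Q' u = m u * Q u + P u * \<phi>' u" using nz by simp
  qed
  have d\<rho>: "(\<rho> has_real_derivative m u * \<rho> u) (at u)" if u: "u \<in> {a<..<b}" for u
  proof -
    have "((\<lambda>u. (P u)\<^sup>2 + (Q u)\<^sup>2) has_real_derivative 2 * (P u * P' u + Q u * Q' u)) (at u)"
      using DERIV_add[OF DERIV_power[OF P[OF u], of 2] DERIV_power[OF Q[OF u], of 2]]
      by (simp add: algebra_simps)
    from DERIV_chain2[OF DERIV_real_sqrt[OF pos[OF u]] this]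
    have "(\<rho> has_real_derivative inverse (\<rho> u) / 2 * (2 * (P u * P' u + Q u * Q' u))) (at u)"
      unfolding \<rho>_def .
    moreover have "inverse (\<rho> u) / 2 * (2 * (P u * P' u + Q u * Q' u)) = m u * \<rho> u"
    proof -
      have "inverse x / 2 * (2 * n) = n / x\<^sup>2 * x" if "x > 0" for x n :: real
        using that by (simp add: field_simps power2_eq_square)
      from this[OF rho(1)[OF u]] show ?thesis unfolding m_def by blast
    qed
    ultimately show ?thesis by (simp only:)
  qed
  have dC: "(C has_real_derivative m u * C u) (at u)" if u: "u \<in> {a<..<b}" for u
    unfolding C_def
    by (rule derivative_eq_intros P[OF u] Q[OF u] \<phi>[OF u] refl)+ (simp add: PQ[OF u] algebra_simps)
  have dS: "(S has_real_derivative m u * S u) (at u)" if u: "u \<in> {a<..<b}" for u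
    unfolding S_def
    by (rule derivative_eq_intros P[OF u] Q[OF u] \<phi>[OF u] refl)+ (simp add: PQ[OF u] algebra_simps)
  have quot: "((\<lambda>u. f u / \<rho> u) has_real_derivative 0) (at u)"
    if "u \<in> {a<..<b}" "(f has_real_derivative m u * f u) (at u)" for f u
    using DERIV_divide[OF that(2) d\<rho>[OF that(1)]] rho[OF that(1)] by (simp add: algebra_simps)
  have ab: "a < b" using u0 by simp
  have const: "C u / \<rho> u = C u0 / \<rho> u0" "S u / \<rho> u = S u0 / \<rho> u0"
    by (rule DERIV_isconst3[OF ab u u0]; use quot dC dS in blast)+
  have P0': "P u0 = \<rho> u0 * cos (\<phi> u0)" and Q0': "Q u0 = \<rho> u0 * sin (\<phi> u0)"
    using P0 Q0 by (simp_all add: \<rho>_def)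
  \<comment> \<open>The initial polar form fixes the two constants: \<open>C / \<rho> = 1\<close>
    and \<open>S / \<rho> = 0\<close>.\<close>
  have "C u0 = \<rho> u0 * ((sin (\<phi> u0))\<^sup>2 + (cos (\<phi> u0))\<^sup>2)" "S u0 = 0"
    unfolding C_def S_def P0' Q0' by algebra+
  then have C: "C u = \<rho> u" and S: "S u = 0"
    using const rho[OF u] rho[OF u0] by (simp_all add: divide_eq_eq)
  have sc: "(sin (\<phi> u))\<^sup>2 + (cos (\<phi> u))\<^sup>2 = 1" by simp
  \<comment> \<open>Rotating back by \<phi> recovers the original vector.\<close>
  have "P u = C u * cos (\<phi> u) - S u * sin (\<phi> u)" "Q u = C u * sin (\<phi> u) + S u * cos (\<phi> u)"
    unfolding C_def S_def using sc by algebra+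
  then have "P u = \<rho> u * cos (\<phi> u)" "Q u = \<rho> u * sin (\<phi> u)"
    by (simp_all add: C S)
  then show "P u = sqrt ((P u)\<^sup>2 + (Q u)\<^sup>2) * cos (\<phi> u)" "Q u = sqrt ((P u)\<^sup>2 + (Q u)\<^sup>2) * sin (\<phi> u)"
    unfolding \<rho>_def .
qed

text \<open>The lightlike condition determines the angular rate of
  \<open>(x\<^sub>1', x\<^sub>2')\<close> up to sign. Connectedness of \<open>J\<close> fixes the
  sign, and an antiderivative of \<open>angle_rate\<close> with the right value at \<open>u0\<close>
  is then the angle by \<open>polar_form_of_angle\<close>.\<close>

lemma angle_of_quasi_minimal:
  assumes J: "open J" "is_interval J"
    and curve: "spacelike_curve J (generating_curve x1 x2 r)"
    and arc: "arc_length_parameterized J (generating_curve x1 x2 r)"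
    and pos: "\<And>u. u \<in> J \<Longrightarrow> r u > 0"
    and qm: "quasi_minimal (J \<times> {0..<2 * pi}) (elliptic_rotational_surface x1 x2 r)"
    and u0: "u0 \<in> J"
  shows "\<exists>I \<eta> \<phi>. open I \<and> is_interval I \<and> I \<subseteq> J \<and> u0 \<in> I \<and> \<eta> \<in> {1, -1} \<and> smooth_on I \<phi> \<and>
    (\<forall>u\<in>I. r u * deriv (deriv r) u + (deriv r u)\<^sup>2 + 1 \<noteq> 0 \<and>
      (\<phi> has_real_derivative angle_rate \<eta> r u) (at u) \<and>
      (x1 has_real_derivative sqrt (1 + (deriv r u)\<^sup>2) * cos (\<phi> u)) (at u) \<and>
      (x2 has_real_derivative sqrt (1 + (deriv r u)\<^sup>2) * sin (\<phi> u)) (at u))"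
proof -
  have smooth: "times_differentiable_on n x1 J" "times_differentiable_on n x2 J"
    "times_differentiable_on n r J" for n
    using curve times_differentiable_on_generating_curve_iff[OF J(1)]
    by (auto simp: spacelike_curve_def smooth_on_open[OF J(1)])
  have unit: "(deriv x1 u)\<^sup>2 + (deriv x2 u)\<^sup>2 - (deriv r u)\<^sup>2 = 1" if "u \<in> J" for u
    using ip_velocity_generating_curve[OF smooth[THEN times_differentiable_on_DERIV_deriv[OF _ that]]]
      arc that by (simp add: arc_length_parameterized_def)
  interpret elliptic_profile J x1 x2 r
    by unfold_locales (fact J smooth pos unit)+
  define A where "A = (\<lambda>u. r u * deriv (deriv r) u + (deriv r u)\<^sup>2 + 1)"
  define K where "K = (\<lambda>u. deriv x1 u * deriv (deriv x2) u - deriv x2 u * deriv (deriv x1) u)"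
  \<comment> \<open>One value of \<open>v\<close> in the parameter range is enough, since the
    criterion is free of \<open>v\<close>; here it is \<open>0\<close>.\<close>
  have A: "A u \<noteq> 0" and KA: "(r u * K u)\<^sup>2 = (A u)\<^sup>2" if "u \<in> J" for u
    using qm that lightlike_mean_curvature_iff[OF that, of 0] by (auto simp: quasi_minimal_def A_def K_def)
  have cont: "continuous_on J f" if "\<And>u. u \<in> J \<Longrightarrow> (f has_real_derivative f' u) (at u)" for f f' :: "real \<Rightarrow> real"
    using that DERIV_isCont continuous_at_imp_continuous_on by blast
  have smooth2: "times_differentiable_on n (deriv (deriv f)) J"
    if "\<And>n. times_differentiable_on n f J" for f :: "real \<Rightarrow> real" and n
    using times_differentiable_on_deriv[OF J(1) times_differentiable_on_deriv[OF J(1) that]] .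
  have cont2: "continuous_on J (deriv (deriv x1))" "continuous_on J (deriv (deriv x2))"
    "continuous_on J (deriv (deriv r))"
    using smooth2[OF smooth(1), of 0] smooth2[OF smooth(2), of 0] smooth2[OF smooth(3), of 0] by auto
  \<comment> \<open>This quotient is the sign at \<open>u\<close>. It is continuous with values in
    \<open>{1, -1}\<close>, hence constant on the interval \<open>J\<close>, and one \<eta> serves
    all points.\<close>
  have "continuous_on J (\<lambda>u. r u * K u / A u)"
    unfolding A_def K_def using A
    by (intro continuous_intros cont2 cont[OF derivs(3)] cont[OF derivs(4)] cont[OF derivs(5)]
        cont[OF derivs(6)] cont[OF derivs(1)] cont[OF derivs(2)]) (auto simp: A_def)
  moreover have sign: "r u * K u / A u \<in> {1, -1}" if "u \<in> J" for u
    using KA[OF that, unfolded power2_eq_iff] A[OF that] by (elim disjE) simp_all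
  then have "(\<lambda>u. r u * K u / A u) ` J \<subseteq> {1, -1}" by blast
  then have "finite ((\<lambda>u. r u * K u / A u) ` J)" by (rule finite_subset) simp
  ultimately have "(\<lambda>u. r u * K u / A u) constant_on J"
    using continuous_finite_range_constant[OF is_interval_connected[OF J(2)]] by blast
  then obtain \<eta> where const: "\<And>u. u \<in> J \<Longrightarrow> r u * K u / A u = \<eta>"
    by (auto simp: constant_on_def)
  then have \<eta>: "\<eta> \<in> {1, -1}" using sign[OF u0] u0 by metis
  have K: "r u * K u = \<eta> * A u" if "u \<in> J" for u
    using const[OF that] A[OF that] by (simp add: field_simps)
  \<comment> \<open>A compact interval around \<open>u0\<close> inside \<open>J\<close> is chosen
    because the antiderivative is taken on \<open>{a..b}\<close>; its interior serves as
    \<open>I\<close>.\<close>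
  obtain e where e: "e > 0" "cball u0 e \<subseteq> J"
    using J(1) u0 open_contains_cball by blast
  define a b where "a = u0 - e" and "b = u0 + e"
  have ab: "{a..b} \<subseteq> J" using e by (simp add: a_def b_def cball_eq_atLeastAtMost)
  then have I: "{a<..<b} \<subseteq> J" by auto
  have u0I: "u0 \<in> {a<..<b}" using e by (simp add: a_def b_def)
  have "continuous_on {a..b} (angle_rate \<eta> r)"
    using times_differentiable_on_angle_rate[OF J(1) smooth(3) pos, of 0]
    by (auto intro: continuous_on_subset[OF _ ab])
  then obtain g where g: "\<And>x. x \<in> {a..b} \<Longrightarrow> (g has_vector_derivative angle_rate \<eta> r x) (at x within {a..b})"
    using antiderivative_continuous by blast
  have unit': "(deriv x1 u)\<^sup>2 + (deriv x2 u)\<^sup>2 = 1 + (deriv r u)\<^sup>2" if "u \<in> J" for u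
    using unit[OF that] by simp
  let ?\<rho> = "\<lambda>u. sqrt ((deriv x1 u)\<^sup>2 + (deriv x2 u)\<^sup>2)"
  \<comment> \<open>The normalized planar velocity at \<open>u0\<close> lies on the unit circle,
    which yields an initial angle \<open>t\<close>.\<close>
  have "(deriv x1 u0 / ?\<rho> u0)\<^sup>2 + (deriv x2 u0 / ?\<rho> u0)\<^sup>2 = 1"
    using less_imp_neq[OF one_plus_square_pos[of "deriv r u0"]] unit'[OF u0]
    by (simp add: power_divide add_nonneg_nonneg flip: add_divide_distrib)
  then obtain t where t: "deriv x1 u0 / ?\<rho> u0 = cos t" "deriv x2 u0 / ?\<rho> u0 = sin t"
    using sincos_total_2pi by metis
  \<comment> \<open>The constant of integration is chosen so that
    \<open>\<phi> u0 = t\<close>.\<close>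
  define \<phi> where "\<phi> = (\<lambda>u. g u + (t - g u0))"
  have \<phi>: "(\<phi> has_real_derivative angle_rate \<eta> r u) (at u)" if "u \<in> {a<..<b}" for u
  proof -
    have "(g has_vector_derivative angle_rate \<eta> r u) (at u)"
      using g[of u] that at_within_interior[of u "{a..b}"] by auto
    then have "(g has_real_derivative angle_rate \<eta> r u) (at u)"
      by (simp add: has_real_derivative_iff_has_vector_derivative)
    then show ?thesis unfolding \<phi>_def by (auto intro!: derivative_eq_intros)
  qed
  have rho0: "?\<rho> u0 > 0" using unit'[OF u0] by simp
  have x12: "deriv x1 u = ?\<rho> u * cos (\<phi> u)" "deriv x2 u = ?\<rho> u * sin (\<phi> u)" if u: "u \<in> {a<..<b}" for u
  proof -
    \<comment> \<open>The \<open>rate\<close> premise of \<open>polar_form_of_angle\<close>: arc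
      length turns the planar speed squared into \<open>1 + (deriv r u)\<^sup>2\<close>, which
      cancels in \<open>angle_rate\<close> and leaves \<open>\<eta> * A u / r u\<close>, that is,
      \<open>K u\<close>.\<close>
    have *: "((deriv x1 u)\<^sup>2 + (deriv x2 u)\<^sup>2) * angle_rate \<eta> r u
        = deriv x1 u * deriv (deriv x2) u - deriv x2 u * deriv (deriv x1) u"
      if "u \<in> {a<..<b}" for u
    proof -
      have u: "u \<in> J" using that I by blast
      have "(1 + (deriv r u)\<^sup>2) * angle_rate \<eta> r u = \<eta> * A u / r u"
        using less_imp_neq[OF one_plus_square_pos[of "deriv r u"]] by (simp add: angle_rate_def A_def)
      also have "\<dots> = K u" using K[OF u] pos[OF u] by (simp add: field_simps)
      finally show ?thesis by (simp add: unit'[OF u] K_def)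
    qed
    have pos': "(deriv x1 u)\<^sup>2 + (deriv x2 u)\<^sup>2 > 0" if "u \<in> {a<..<b}" for u
      using unit'[of u] that I by auto
    have init: "deriv x1 u0 = ?\<rho> u0 * cos (\<phi> u0)" "deriv x2 u0 = ?\<rho> u0 * sin (\<phi> u0)"
      using rho0 by (simp_all add: \<phi>_def flip: t)
    note d = derivs(4,5)[OF subsetD[OF I]]
    show "deriv x1 u = ?\<rho> u * cos (\<phi> u)" "deriv x2 u = ?\<rho> u * sin (\<phi> u)"
      using polar_form_of_angle[OF u0I d \<phi> pos' * init u] by blast+
  qed
  have "times_differentiable_on n (angle_rate \<eta> r) {a<..<b}" for n
    using times_differentiable_on_subset[OF times_differentiable_on_angle_rate[OF J(1) smooth(3) pos] I] .
  then have "smooth_on {a<..<b} \<phi>"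
    using times_differentiable_on_antiderivative[OF open_greaterThanLessThan \<phi>]
    by (simp add: smooth_on_open del: greaterThanLessThan_iff)
  moreover have "(x1 has_real_derivative sqrt (1 + (deriv r u)\<^sup>2) * cos (\<phi> u)) (at u)"
    "(x2 has_real_derivative sqrt (1 + (deriv r u)\<^sup>2) * sin (\<phi> u)) (at u)" if "u \<in> {a<..<b}" for u
  proof -
    have "u \<in> J" using that I by blast
    then show "(x1 has_real_derivative sqrt (1 + (deriv r u)\<^sup>2) * cos (\<phi> u)) (at u)"
      "(x2 has_real_derivative sqrt (1 + (deriv r u)\<^sup>2) * sin (\<phi> u)) (at u)"
      using derivs(1,2)[of u] x12[OF that] unit'[of u] by simp_all
  qed
  ultimately show ?thesis
    using I u0I \<eta> \<phi> A
    by (intro exI[of _ "{a<..<b}"] exI[of _ \<eta>] exI[of _ \<phi>]) (auto simp: A_def is_interval_oo)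
qed

theorem theorem3p3:
  shows
    "(\<forall>(I :: real set) (r :: real \<Rightarrow> real) (\<eta> :: real) (\<phi> :: real \<Rightarrow> real)
        (x1 :: real \<Rightarrow> real) (x2 :: real \<Rightarrow> real).
        open I \<and> is_interval I \<and>
        smooth_on I r \<and> (\<forall>u\<in>I. r u > 0) \<and>
        (\<forall>u\<in>I. r u * deriv (deriv r) u + (deriv r u)\<^sup>2 + 1 \<noteq> 0) \<and>
        \<eta> \<in> {1, -1} \<and>
        (\<forall>u\<in>I. (\<phi> has_real_derivative
            \<eta> * ((r u * deriv (deriv r) u + (deriv r u)\<^sup>2 + 1) / (r u * (1 + (deriv r u)\<^sup>2)))) (at u)) \<and>
        (\<forall>u\<in>I. (x1 has_real_derivative sqrt (1 + (deriv r u)\<^sup>2) * cos (\<phi> u)) (at u)) \<and>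
        (\<forall>u\<in>I. (x2 has_real_derivative sqrt (1 + (deriv r u)\<^sup>2) * sin (\<phi> u)) (at u))
        \<longrightarrow>
        spacelike_curve I (generating_curve x1 x2 r) \<and>
        arc_length_parameterized I (generating_curve x1 x2 r) \<and>
        quasi_minimal (I \<times> {0..<2 * pi}) (elliptic_rotational_surface x1 x2 r))
     \<and>
     (\<forall>(J :: real set) (x1 :: real \<Rightarrow> real) (x2 :: real \<Rightarrow> real) (r :: real \<Rightarrow> real).
        open J \<and> is_interval J \<and>
        spacelike_curve J (generating_curve x1 x2 r) \<and>
        arc_length_parameterized J (generating_curve x1 x2 r) \<and>
        (\<forall>u\<in>J. r u > 0) \<and>
        quasi_minimal (J \<times> {0..<2 * pi}) (elliptic_rotational_surface x1 x2 r)
        \<longrightarrow>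
        (\<forall>u0\<in>J. \<exists>(I :: real set) (\<eta> :: real) (\<phi> :: real \<Rightarrow> real).
           open I \<and> is_interval I \<and> I \<subseteq> J \<and> u0 \<in> I \<and>
           \<eta> \<in> {1, -1} \<and> smooth_on I \<phi> \<and>
           (\<forall>u\<in>I.
              r u * deriv (deriv r) u + (deriv r u)\<^sup>2 + 1 \<noteq> 0 \<and>
              (\<phi> has_real_derivative
                \<eta> * ((r u * deriv (deriv r) u + (deriv r u)\<^sup>2 + 1) / (r u * (1 + (deriv r u)\<^sup>2)))) (at u) \<and>
              (x1 has_real_derivative sqrt (1 + (deriv r u)\<^sup>2) * cos (\<phi> u)) (at u) \<and>
              (x2 has_real_derivative sqrt (1 + (deriv r u)\<^sup>2) * sin (\<phi> u)) (at u))))"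
proof (intro conjI allI impI ballI; elim conjE)
  fix I :: "real set" and r :: "real \<Rightarrow> real" and \<eta> :: real and \<phi> x1 x2 :: "real \<Rightarrow> real"
  assume "open I" "smooth_on I r" "\<forall>u\<in>I. r u > 0"
    "\<forall>u\<in>I. r u * deriv (deriv r) u + (deriv r u)\<^sup>2 + 1 \<noteq> 0" "\<eta> \<in> {1, -1}"
    "\<forall>u\<in>I. (\<phi> has_real_derivative
      \<eta> * ((r u * deriv (deriv r) u + (deriv r u)\<^sup>2 + 1) / (r u * (1 + (deriv r u)\<^sup>2)))) (at u)"
    "\<forall>u\<in>I. (x1 has_real_derivative sqrt (1 + (deriv r u)\<^sup>2) * cos (\<phi> u)) (at u)"
    "\<forall>u\<in>I. (x2 has_real_derivative sqrt (1 + (deriv r u)\<^sup>2) * sin (\<phi> u)) (at u)"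
  note hyps = this(1,2) this(3,4)[THEN bspec] this(5) this(6)[folded angle_rate_def, THEN bspec]
    this(7,8)[THEN bspec]
  show "spacelike_curve I (generating_curve x1 x2 r)"
    and "arc_length_parameterized I (generating_curve x1 x2 r)"
    and "quasi_minimal (I \<times> {0..<2 * pi}) (elliptic_rotational_surface x1 x2 r)"
    using quasi_minimal_of_angle[OF hyps] by blast+
next
  fix J :: "real set" and x1 x2 r :: "real \<Rightarrow> real" and u0 :: real
  assume "open J" "is_interval J" "spacelike_curve J (generating_curve x1 x2 r)"
    "arc_length_parameterized J (generating_curve x1 x2 r)" "\<forall>u\<in>J. r u > 0"
    "quasi_minimal (J \<times> {0..<2 * pi}) (elliptic_rotational_surface x1 x2 r)" "u0 \<in> J"
  note hyps = this(1-4) this(5)[THEN bspec] this(6,7)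
  show "\<exists>I \<eta> \<phi>. open I \<and> is_interval I \<and> I \<subseteq> J \<and> u0 \<in> I \<and> \<eta> \<in> {1, -1} \<and> smooth_on I \<phi> \<and>
      (\<forall>u\<in>I. r u * deriv (deriv r) u + (deriv r u)\<^sup>2 + 1 \<noteq> 0 \<and>
        (\<phi> has_real_derivative
          \<eta> * ((r u * deriv (deriv r) u + (deriv r u)\<^sup>2 + 1) / (r u * (1 + (deriv r u)\<^sup>2)))) (at u) \<and>
        (x1 has_real_derivative sqrt (1 + (deriv r u)\<^sup>2) * cos (\<phi> u)) (at u) \<and>
        (x2 has_real_derivative sqrt (1 + (deriv r u)\<^sup>2) * sin (\<phi> u)) (at u))"
    using angle_of_quasi_minimal[OF hyps] unfolding angle_rate_def .
qed

end
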